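(* Let $k,l\ge 2$ be integers and let $G$ be a uniform graph of type $(k,l)$ with $n$ edges. Then the following statements hold: 1) The number $s=\dfrac{n}{n(k,l)}$ is an integer. 2) The graph $G$ is $v(k,l)$-vertex-colorable and $f(k,l)$-face-colorable. Furthermore, there exist a proper vertex coloring of $G$ with $v(k,l)$ colors and a proper face coloring of $G$ with $f(k,l)$ colors such that the sum of the degrees of all vertices of any single color is equal to $ks$, and the sum of the degrees of all faces of any single color is equal to $ls$.
   Context: "Graph" means a finite connected plane graph (embedded in the sphere) with at least one edge, possibly with multiple edges and loops. The degree of a vertex counts each loop twice; the degree of a face is the length of its boundary walk (an edge having the same face on both sides is counted twice). For integers $k,l\ge 2$, a graph is uniform of type $(k,l)$ if all its vertex degrees are divisible by $k$ and all its face degrees are divisible by $l$. By Euler's formula a uniform graph of type $(k,l)$ can exist only if, up to interchanging $k$ and $l$, $(k,l)$ is one of $(2,r)$ with $r\ge 2$, $(3,3)$, $(3,4)$, $(3,5)$. For each such pair there is a unique (up to equivalence) graph all of whose vertices have degree exactly $k$ and all of whose faces have degree exactly $l$, called the Platonic graph of type $(k,l)$ (these are the graphs of the Platonic solids, completed by the cycles, of type $(2,r)$, and their duals, of type $(r,2)$). The numbers of its edges, vertices and faces are denoted $n(k,l)$, $v(k,l)$, $f(k,l)$; thus $n(k,l)=\frac{2kl}{2k+2l-kl}$, $v(k,l)=2n(k,l)/k$, $f(k,l)=2n(k,l)/l$. A proper vertex coloring assigns different colors to the endpoints of every edge (in particular, it cannot exist if there are loops); a proper face coloring is a proper vertex coloring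 of the dual graph. A graph is $m$-vertex-colorable (respectively $m$-face-colorable) if it has a proper vertex (respectively face) coloring with $m$ colors. *)

theory Defs
  imports
    Complex_Main
    "HOL-Combinatorics.Orbits"
    "Graph_Theory.Digraph_Component"
    "Graph_Theory.Bidirected_Digraph"
begin

text \<open>
  A plane graph, considered up to orientation-preserving homeomorphism of the sphere, is given by
  its combinatorial map. The underlying multigraph is a bidirected digraph: every edge is a pair of
  mutually reverse arcs \<open>a\<close>, \<open>opp a\<close>, and a loop is a pair of arcs that both start (and end) at the
  same vertex. The embedding is recorded by \<open>nxt\<close>, which maps an arc leaving \<open>v\<close> to the next arc
  leaving \<open>v\<close> in the cyclic (say, counterclockwise) order around \<open>v\<close>.
\<close>

definition edges :: "('v, 'a) pre_digraph \<Rightarrow> ('a \<Rightarrow> 'a) \<Rightarrow> 'a set set" where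
  "edges G opp = (\<lambda>a. {a, opp a}) ` arcs G"

text \<open>
  To walk along the boundary of a face, traverse an arc and leave its head by the arc following
  the reversed one in the rotation. A face is represented by the set of arcs on its boundary walk.
  An edge with the same face on both sides contributes both of its arcs to that face.
\<close>

definition face_step :: "('a \<Rightarrow> 'a) \<Rightarrow> ('a \<Rightarrow> 'a) \<Rightarrow> 'a \<Rightarrow> 'a" where
  "face_step opp nxt a = nxt (opp a)"

definition face_of :: "('a \<Rightarrow> 'a) \<Rightarrow> ('a \<Rightarrow> 'a) \<Rightarrow> 'a \<Rightarrow> 'a set" where
  "face_of opp nxt a = orbit (face_step opp nxt) a"

definition faces :: "('v, 'a) pre_digraph \<Rightarrow> ('a \<Rightarrow> 'a) \<Rightarrow> ('a \<Rightarrow> 'a) \<Rightarrow> 'a set set" where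
  "faces G opp nxt = face_of opp nxt ` arcs G"

definition face_degree :: "'a set \<Rightarrow> nat" where
  "face_degree F = card F"

text \<open>
  The closed oriented surface obtained by gluing a disc along every boundary walk is connected,
  and it is the sphere iff its Euler characteristic is 2.
\<close>

locale plane_graph = fin_digraph G + bidirected_digraph G opp
  for G :: "('v, 'a) pre_digraph" and opp :: "'a \<Rightarrow> 'a" +
  fixes nxt :: "'a \<Rightarrow> 'a"
  assumes connected: "connected G"
    and arcs_nonempty: "arcs G \<noteq> {}"
    and nxt_cyclic: "v \<in> verts G \<Longrightarrow> cyclic_on nxt (out_arcs G v)"
    and euler_sphere:
      "int (card (verts G)) - int (card (edges G opp)) + int (card (faces G opp nxt)) = 2"

text \<open>
  Since a loop consists of two arcs leaving its vertex, \<open>out_degree\<close> is the vertex degree in which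
  loops are counted twice.
\<close>

definition uniform_graph ::
  "nat \<Rightarrow> nat \<Rightarrow> ('v, 'a) pre_digraph \<Rightarrow> ('a \<Rightarrow> 'a) \<Rightarrow> ('a \<Rightarrow> 'a) \<Rightarrow> bool" where
  "uniform_graph k l G opp nxt \<longleftrightarrow> plane_graph G opp nxt \<and>
     (\<forall>v \<in> verts G. k dvd out_degree G v) \<and>
     (\<forall>F \<in> faces G opp nxt. l dvd face_degree F)"

definition platonic_graph ::
  "nat \<Rightarrow> nat \<Rightarrow> ('v, 'a) pre_digraph \<Rightarrow> ('a \<Rightarrow> 'a) \<Rightarrow> ('a \<Rightarrow> 'a) \<Rightarrow> bool" where
  "platonic_graph k l G opp nxt \<longleftrightarrow> plane_graph G opp nxt \<and>
     (\<forall>v \<in> verts G. out_degree G v = k) \<and>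
     (\<forall>F \<in> faces G opp nxt. face_degree F = l)"

text \<open>
  The numbers \<open>n(k,l)\<close>, \<open>v(k,l)\<close>, \<open>f(k,l)\<close> of edges, vertices and faces of the Platonic graph of
  type \<open>(k,l)\<close>, with vertices and arcs taken to be natural numbers. They are meaningful only for
  those \<open>(k,l)\<close> for which such a graph exists; the lemmas \<open>platonic_numbers\<close> and
  \<open>platonic_graph_formulas\<close> below show that they are then well defined and given by the usual
  formulas.
\<close>

definition platonic_n :: "nat \<Rightarrow> nat \<Rightarrow> nat" where
  "platonic_n k l = (THE m. \<exists>(P :: (nat, nat) pre_digraph) opp nxt.
     platonic_graph k l P opp nxt \<and> card (edges P opp) = m)"

definition platonic_v :: "nat \<Rightarrow> nat \<Rightarrow> nat" where
  "platonic_v k l = (THE m. \<exists>(P :: (nat, nat) pre_digraph) opp nxt.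
     platonic_graph k l P opp nxt \<and> card (verts P) = m)"

definition platonic_f :: "nat \<Rightarrow> nat \<Rightarrow> nat" where
  "platonic_f k l = (THE m. \<exists>(P :: (nat, nat) pre_digraph) opp nxt.
     platonic_graph k l P opp nxt \<and> card (faces P opp nxt) = m)"

definition proper_vertex_coloring :: "('v, 'a) pre_digraph \<Rightarrow> nat \<Rightarrow> ('v \<Rightarrow> nat) \<Rightarrow> bool" where
  "proper_vertex_coloring G m c \<longleftrightarrow>
     (\<forall>v \<in> verts G. c v < m) \<and> (\<forall>a \<in> arcs G. c (tail G a) \<noteq> c (head G a))"

definition dual_graph ::
  "('v, 'a) pre_digraph \<Rightarrow> ('a \<Rightarrow> 'a) \<Rightarrow> ('a \<Rightarrow> 'a) \<Rightarrow> ('a set, 'a) pre_digraph" where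
  "dual_graph G opp nxt =
     \<lparr>verts = faces G opp nxt, arcs = arcs G,
      tail = face_of opp nxt, head = (\<lambda>a. face_of opp nxt (opp a))\<rparr>"

definition proper_face_coloring ::
  "('v, 'a) pre_digraph \<Rightarrow> ('a \<Rightarrow> 'a) \<Rightarrow> ('a \<Rightarrow> 'a) \<Rightarrow> nat \<Rightarrow> ('a set \<Rightarrow> nat) \<Rightarrow> bool" where
  "proper_face_coloring G opp nxt m c \<longleftrightarrow> proper_vertex_coloring (dual_graph G opp nxt) m c"

definition vertex_colorable :: "('v, 'a) pre_digraph \<Rightarrow> nat \<Rightarrow> bool" where
  "vertex_colorable G m \<longleftrightarrow> (\<exists>c. proper_vertex_coloring G m c)"

definition face_colorable ::
  "('v, 'a) pre_digraph \<Rightarrow> ('a \<Rightarrow> 'a) \<Rightarrow> ('a \<Rightarrow> 'a) \<Rightarrow> nat \<Rightarrow> bool" where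
  "face_colorable G opp nxt m \<longleftrightarrow> (\<exists>c. proper_face_coloring G opp nxt m c)"

context plane_graph
begin

lemma card_arcs_edges: "card (arcs G) = 2 * card (edges G opp)"
proof -
  have U: "\<Union> (edges G opp) = arcs G"
    by (auto simp: edges_def)
  have "card (\<Union> (edges G opp)) = (\<Sum>e\<in>edges G opp. card e)"
  proof (rule card_Union_disjoint)
    show "pairwise disjnt (edges G opp)"
      unfolding pairwise_def disjnt_def edges_def by (auto simp: arev_eq_iff)
  qed (auto simp: edges_def)
  also have "\<dots> = (\<Sum>e\<in>edges G opp. 2)"
  proof (rule sum.cong)
    fix e assume "e \<in> edges G opp"
    then obtain a where "a \<in> arcs G" "e = {a, opp a}" by (auto simp: edges_def)
    then show "card e = 2" using arev_neq[of a] by (simp add: eq_commute[of a])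
  qed simp
  finally show ?thesis by (simp add: U)
qed

lemma card_arcs_out_degree: "card (arcs G) = (\<Sum>v\<in>verts G. out_degree G v)"
proof -
  have "arcs G = (\<Union>v\<in>verts G. out_arcs G v)" by auto
  also have "card \<dots> = (\<Sum>v\<in>verts G. card (out_arcs G v))"
    by (rule card_UN_disjoint) auto
  finally show ?thesis by (simp add: out_degree_def)
qed

lemma nxt_out_arcs:
  assumes "a \<in> arcs G" shows "nxt a \<in> out_arcs G (tail G a)"
  using cyclic_on_inI[OF nxt_cyclic] assms by auto

lemma nxt_inj: "inj_on nxt (arcs G)"
proof (rule inj_onI)
  fix a b assume ab: "a \<in> arcs G" "b \<in> arcs G" "nxt a = nxt b"
  then have t: "tail G a = tail G b"
    using nxt_out_arcs[of a] nxt_out_arcs[of b] by simp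
  let ?S = "out_arcs G (tail G a)"
  have c: "cyclic_on nxt ?S" using ab nxt_cyclic by simp
  have "nxt ` ?S = ?S"
  proof
    show "nxt ` ?S \<subseteq> ?S" using cyclic_on_inI[OF c] by blast
    show "?S \<subseteq> nxt ` ?S"
    proof
      fix x assume "x \<in> ?S"
      then have "x \<in> orbit nxt x" "orbit nxt x = ?S"
        using orbit_cyclic_eq3[OF c] by blast+
      then show "x \<in> nxt ` ?S" using \<open>x \<in> ?S\<close> by cases auto
    qed
  qed
  then have "inj_on nxt ?S" by (simp add: eq_card_imp_inj_on finite_out_arcs)
  then show "a = b" using ab t by (auto dest: inj_onD)
qed

lemma face_step_inj: "inj_on (face_step opp nxt) (arcs G)"
proof (rule inj_onI)
  fix a b assume "a \<in> arcs G" "b \<in> arcs G" "face_step opp nxt a = face_step opp nxt b"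
  then have "opp a = opp b"
    using inj_onD[OF nxt_inj, of "opp a" "opp b"] by (simp add: face_step_def)
  then show "a = b" by (simp add: arev_eq_iff)
qed

lemma face_step_arcs: "a \<in> arcs G \<Longrightarrow> face_step opp nxt a \<in> arcs G"
  using nxt_out_arcs[of "opp a"] by (simp add: face_step_def)

lemma face_of_subset:
  assumes "a \<in> arcs G" shows "face_of opp nxt a \<subseteq> arcs G"
proof
  fix b assume "b \<in> face_of opp nxt a"
  then show "b \<in> arcs G" unfolding face_of_def
    by induction (auto intro: assms face_step_arcs)
qed

text \<open>Outside of \<open>arcs G\<close> the function \<open>face_step opp nxt\<close> need not be injective.\<close>

definition face_perm :: "'a \<Rightarrow> 'a" where
  "face_perm = perm_restrict (face_step opp nxt) (arcs G)"

lemma face_perm_permutes: "face_perm permutes arcs G"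
proof -
  have *: "\<And>x. x \<in> arcs G \<Longrightarrow> face_perm x = face_step opp nxt x"
    by (simp add: face_perm_def perm_restrict_def)
  have "inj_on face_perm (arcs G)"
    using face_step_inj * by (auto simp: inj_on_def)
  moreover have "face_perm ` arcs G \<subseteq> arcs G" using * face_step_arcs by auto
  ultimately have "bij_betw face_perm (arcs G) (arcs G)"
    by (simp add: bij_betw_def endo_inj_surj)
  then show ?thesis
    by (rule bij_imp_permutes) (simp add: face_perm_def perm_restrict_def)
qed

lemma permutation_face_perm: "permutation face_perm"
  using face_perm_permutes finite_arcs unfolding permutation_permutes by blast

lemma face_of_eq_orbit:
  assumes "a \<in> arcs G" shows "face_of opp nxt a = orbit face_perm a"
  unfolding face_of_def
  by (rule orbit_cong0[where A = "arcs G"])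
     (use assms face_step_arcs in \<open>auto simp: face_perm_def perm_restrict_def\<close>)

lemma face_of_self: "a \<in> arcs G \<Longrightarrow> a \<in> face_of opp nxt a"
  using permutation_self_in_orbit[OF permutation_face_perm] by (simp add: face_of_eq_orbit)

lemma face_of_eq:
  assumes "a \<in> arcs G" "b \<in> face_of opp nxt a"
  shows "face_of opp nxt b = face_of opp nxt a"
proof -
  have "b \<in> arcs G" using face_of_subset assms by auto
  moreover have "orbit face_perm b = orbit face_perm a"
    using assms orbit_cyclic_eq3[OF cyclic_on_orbit'[OF permutation_face_perm]]
    by (simp add: face_of_eq_orbit)
  ultimately show ?thesis using assms by (simp add: face_of_eq_orbit)
qed

lemma card_arcs_face_degree: "card (arcs G) = (\<Sum>F\<in>faces G opp nxt. face_degree F)"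
proof -
  have "\<Union> (faces G opp nxt) = arcs G"
    using face_of_subset face_of_self by (auto simp: faces_def)
  moreover have "card (\<Union> (faces G opp nxt)) = (\<Sum>F\<in>faces G opp nxt. card F)"
  proof (rule card_Union_disjoint)
    show "pairwise disjnt (faces G opp nxt)"
      unfolding pairwise_def disjnt_def faces_def
      by clarsimp (metis disjoint_iff face_of_eq)
    show "\<And>F. F \<in> faces G opp nxt \<Longrightarrow> finite F"
      using face_of_subset finite_subset[OF _ finite_arcs] by (auto simp: faces_def)
  qed
  ultimately show ?thesis by (simp add: face_degree_def)
qed

end

lemma platonic_graph_formulas:
  assumes "platonic_graph k l P opp nxt"
  shows "int (card (edges P opp)) * (2 * int k + 2 * int l - int k * int l) = 2 * int k * int l"
    and "k * card (verts P) = 2 * card (edges P opp)"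
    and "l * card (faces P opp nxt) = 2 * card (edges P opp)"
proof -
  interpret plane_graph P opp nxt using assms by (simp add: platonic_graph_def)
  let ?n = "card (edges P opp)" let ?v = "card (verts P)" let ?f = "card (faces P opp nxt)"
  show v: "k * ?v = 2 * ?n"
    using card_arcs_out_degree card_arcs_edges assms by (simp add: platonic_graph_def)
  show f: "l * ?f = 2 * ?n"
    using card_arcs_face_degree card_arcs_edges assms by (simp add: platonic_graph_def)
  have v': "int k * int ?v = 2 * int ?n" and f': "int l * int ?f = 2 * int ?n"
    using v f by (metis of_nat_mult of_nat_numeral)+
  have "int k * int l * (int ?v - int ?n + int ?f) = 2 * int k * int l"
    using euler_sphere by simp
  then have "int l * (int k * int ?v) - int k * int l * int ?n + int k * (int l * int ?f)
      = 2 * int k * int l"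
    by (simp add: algebra_simps)
  then show "int ?n * (2 * int k + 2 * int l - int k * int l) = 2 * int k * int l"
    unfolding v' f' by (simp add: algebra_simps)
qed

lemma platonic_numbers:
  fixes P :: "(nat, nat) pre_digraph"
  assumes "platonic_graph k l P opp nxt" "k > 0" "l > 0"
  shows "platonic_n k l = card (edges P opp)"
    and "platonic_v k l = card (verts P)"
    and "platonic_f k l = card (faces P opp nxt)"
proof -
  have *: "card (edges Q o') = card (edges P opp) \<and> card (verts Q) = card (verts P) \<and>
      card (faces Q o' x') = card (faces P opp nxt)"
    if "platonic_graph k l Q o' x'" for Q :: "(nat, nat) pre_digraph" and o' x'
  proof -
    note P = platonic_graph_formulas[OF assms(1)] and Q = platonic_graph_formulas[OF that]
    have "2 * int k + 2 * int l - int k * int l \<noteq> 0"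
      using P(1) assms(2,3) by auto
    then have "card (edges Q o') = card (edges P opp)"
      using P(1) Q(1) by (metis mult_right_cancel of_nat_eq_iff)
    then show ?thesis
      using P(2,3) Q(2,3) assms(2,3) by (metis mult_left_cancel less_not_refl2)
  qed
  show "platonic_n k l = card (edges P opp)"
    unfolding platonic_n_def by (rule the_equality) (use * assms(1) in blast)+
  show "platonic_v k l = card (verts P)"
    unfolding platonic_v_def by (rule the_equality) (use * assms(1) in blast)+
  show "platonic_f k l = card (faces P opp nxt)"
    unfolding platonic_f_def by (rule the_equality) (use * assms(1) in blast)+
qed

end

theory Submission
  imports Defs
begin

text \<open>
  Write \<open>\<sigma>\<close> for the rotation \<open>nxt\<close> and \<open>\<alpha>\<close> for arc reversal; the vertices of a plane graph are
  the cycles of \<open>\<sigma>\<close> on the set \<open>D\<close> of its arcs, the edges those of \<open>\<alpha>\<close>, the faces those of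
  \<open>\<sigma> \<circ> \<alpha>\<close>. Let \<open>Q\<close> be the set of arcs of the Platonic graph of type \<open>(k,l)\<close>. The theorem follows
  from the existence of a map \<open>\<phi> : D \<rightarrow> Q\<close> that commutes with rotation and with reversal. Such a
  \<open>\<phi>\<close> is a covering of the sphere by the sphere, branched only over vertices and face centres, and
  it is obtained topologically by developing \<open>G\<close> onto the Platonic graph: the divisibility of the
  degrees says that the holonomy around each vertex and each face is trivial, and the sphere is
  simply connected.

  Given \<open>\<phi>\<close>, colour a vertex or a face of \<open>G\<close> by its image. Adjacent vertices (faces) of a Platonic
  graph are distinct, so both colourings are proper. All fibres of \<open>\<phi>\<close> have the same size because
  \<open>\<sigma>\<close> and \<open>\<alpha>\<close> act transitively on \<open>Q\<close>; that size is \<open>s = |D| / |Q|\<close>, and the arcs leaving the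
  vertices of one colour form \<open>k\<close> fibres.

  The combinatorial substitute for simple connectivity is Euler's inequality \<open>\<chi> \<le> 2\<close> for every
  connected map, in the form of \<open>euler_characteristic_le\<close> for maps with any number \<open>c\<close> of components:
  \<open>\<chi> \<le> 2 c\<close>. It is applied to the product map on \<open>D \<times> Q\<close>. By the divisibility hypotheses every
  cycle of \<open>D\<close> lifts to at least \<open>|Q|\<close> cycles (\<open>card_cycles_product_ge\<close>), so the product has characteristic
  at least \<open>2 |Q|\<close> and hence at least \<open>|Q|\<close> components. As each component projects onto the connected
  map \<open>D\<close>, there are no more than \<open>|Q|\<close> of them and each one meets every fibre of \<open>D \<times> Q \<rightarrow> D\<close>
  exactly once: each component is the graph of a map \<open>\<phi>\<close> as required (\<open>equivariant_map_exists\<close>).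

  The numbers \<open>n(k,l)\<close>, \<open>v(k,l)\<close>, \<open>f(k,l)\<close> and the set \<open>Q\<close> come from explicit Platonic maps, one for
  each type that is left possible by Euler's formula, up to duality.
\<close>

section \<open>Equivalence classes generated by a relation\<close>

definition link :: "('a \<times> 'a) set \<Rightarrow> ('a \<times> 'a) set" where
  "link r = (r \<union> r\<inverse>)\<^sup>*"

definition graph_on :: "'a set \<Rightarrow> ('a \<Rightarrow> 'a) \<Rightarrow> ('a \<times> 'a) set" where
  "graph_on D f = (\<lambda>x. (x, f x)) ` D"

lemma equiv_link: "equiv UNIV (link r)"
  unfolding link_def equiv_def by (auto simp: refl_on_def trans_rtrancl sym_rtrancl sym_Un_converse)

lemma link_refl [simp]: "(x, x) \<in> link r"
  by (simp add: link_def)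

lemma link_sym: "(x, y) \<in> link r \<Longrightarrow> (y, x) \<in> link r"
  using equiv_link[of r] by (auto simp: equiv_def dest: symD)

lemma link_trans: "(x, y) \<in> link r \<Longrightarrow> (y, z) \<in> link r \<Longrightarrow> (x, z) \<in> link r"
  using equiv_link[of r] by (auto simp: equiv_def dest: transD)

lemma link_incl: "r \<subseteq> link r"
  by (auto simp: link_def)

lemma link_minimal:
  assumes "r \<subseteq> link r'" shows "link r \<subseteq> link r'"
proof -
  have "(x, y) \<in> link r'" if "(x, y) \<in> link r" for x y
    using that unfolding link_def[of r]
  proof induction
    case (step y z)
    then have "(y, z) \<in> r \<or> (z, y) \<in> r" by auto
    then have "(y, z) \<in> link r'" using assms link_sym[of z y r'] by auto
    then show ?case using step.IH link_trans by metis
  qed simp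
  then show ?thesis by auto
qed

lemma link_mono: "r \<subseteq> r' \<Longrightarrow> link r \<subseteq> link r'"
  by (rule link_minimal) (rule subset_trans[OF _ link_incl])

lemma link_insert_iff:
  "(x, y) \<in> link (insert (a, b) r) \<longleftrightarrow> (x, y) \<in> link r \<or>
     (x, a) \<in> link r \<and> (b, y) \<in> link r \<or> (x, b) \<in> link r \<and> (a, y) \<in> link r" (is "?L \<longleftrightarrow> ?R x y")
proof
  assume ?L
  then show "?R x y" unfolding link_def[of "insert _ _"]
  proof induction
    case (step y z)
    have "(y, z) \<in> link r \<or> (y, z) = (a, b) \<or> (y, z) = (b, a)"
      using step.hyps(2) link_incl[of r] link_sym[of z y r] by auto
    then show ?case
    proof (elim disjE)
      assume "(y, z) \<in> link r"
      then show ?case using step.IH link_trans by metis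
    next
      assume "(y, z) = (a, b)"
      then show ?case using step.IH link_sym link_trans link_refl by (metis prod.inject)
    next
      assume "(y, z) = (b, a)"
      then show ?case using step.IH link_sym link_trans link_refl by (metis prod.inject)
    qed
  qed simp
next
  let ?I = "link (insert (a, b) r)"
  have ab: "(a, b) \<in> ?I" using link_incl by blast
  have r: "(x, y) \<in> ?I" if "(x, y) \<in> link r" for x y
    using that link_mono[of r "insert (a, b) r"] by blast
  assume "?R x y"
  then show ?L using ab r link_sym link_trans by metis
qed

lemma link_insert_linked: "(a, b) \<in> link r \<Longrightarrow> link (insert (a, b) r) = link r"
  by (intro equalityI link_minimal link_mono) (use link_incl in auto)

lemma in_class_iff: "link r `` {x} = link r `` {y} \<longleftrightarrow> (x, y) \<in> link r"
  using eq_equiv_class_iff[OF equiv_link, of x y r] by simp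

text \<open>
  Adding the pair \<open>(a, b)\<close> identifies the class of \<open>a\<close> with that of \<open>b\<close> and leaves the other classes
  alone. A bijection onto the new classes, rather than a bound, gives the exact decrease by one that
  the induction for Euler's inequality needs.
\<close>

lemma bij_betw_merged_classes:
  assumes ab: "a \<in> D" "b \<in> D" "(a, b) \<notin> link r"
  shows "bij_betw (\<lambda>C. link (insert (a, b) r) `` C) (D // link r - {link r `` {a}})
           (D // link (insert (a, b) r))"
proof -
  let ?R = "link r" and ?R' = "link (insert (a, b) r)"
  have img: "?R' `` (?R `` {x}) = ?R' `` {x}" for x
    using link_mono[of r "insert (a, b) r"] by (auto intro: link_trans)
  have D: "C \<in> D // ?R - {?R `` {a}} \<longleftrightarrow> (\<exists>x\<in>D. C = ?R `` {x} \<and> (x, a) \<notin> ?R)" for C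
    unfolding quotient_def using in_class_iff[of r] by blast
  have ab': "?R' `` {a} = ?R' `` {b}"
    by (simp add: in_class_iff link_insert_iff)
  show ?thesis unfolding bij_betw_def
  proof
    show "inj_on (\<lambda>C. ?R' `` C) (D // ?R - {?R `` {a}})"
    proof (rule inj_onI)
      fix C C' assume "C \<in> D // ?R - {?R `` {a}}" "C' \<in> D // ?R - {?R `` {a}}"
        and eq: "?R' `` C = ?R' `` C'"
      then obtain x y where x: "C = ?R `` {x}" "(x, a) \<notin> ?R" and y: "C' = ?R `` {y}" "(y, a) \<notin> ?R"
        unfolding D by blast
      then have "(x, y) \<in> ?R'" using eq by (simp add: img in_class_iff)
      then show "C = C'" using x y link_sym[of a y r] by (auto simp: in_class_iff link_insert_iff)
    qed
    show "(\<lambda>C. ?R' `` C) ` (D // ?R - {?R `` {a}}) = D // ?R'"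
    proof (intro equalityI subsetI)
      fix C assume "C \<in> D // ?R'"
      then obtain x where x: "x \<in> D" "C = ?R' `` {x}" by (auto simp: quotient_def)
      show "C \<in> (\<lambda>C. ?R' `` C) ` (D // ?R - {?R `` {a}})"
      proof (cases "(x, a) \<in> ?R")
        case True
        then have "?R' `` {x} = ?R' `` (?R `` {b})"
          using ab' by (metis img in_class_iff)
        moreover have "?R `` {b} \<in> D // ?R - {?R `` {a}}"
          using ab D link_sym[of b a r] by blast
        ultimately show ?thesis using x by blast
      next
        case False
        then have "?R `` {x} \<in> D // ?R - {?R `` {a}}" using x D by blast
        then show ?thesis using x img by blast
      qed
    qed (auto simp: quotient_def img)
  qed
qed

lemma finite_classes: "finite D \<Longrightarrow> finite (D // link r)"
  by (simp add: quotient_def)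

lemma card_classes_insert:
  assumes "finite D" "a \<in> D" "b \<in> D" "(a, b) \<notin> link r"
  shows "card (D // link (insert (a, b) r)) + 1 = card (D // link r)"
proof -
  have "link r `` {a} \<in> D // link r" using assms(2) by (rule quotientI)
  then have "card (D // link r - {link r `` {a}}) + 1 = card (D // link r)"
    using finite_classes[OF assms(1), of r] card_Suc_Diff1 by fastforce
  then show ?thesis
    using bij_betw_same_card[OF bij_betw_merged_classes[OF assms(2-4)]] by simp
qed

section \<open>Cycles of a permutation and transpositions\<close>

lemma bij_betw_funpow_period:
  assumes "finite D" "bij_betw f D D" "x \<in> D"
  shows "\<exists>p>0. (f ^^ p) x = x"
proof -
  have "perm_restrict f D permutes D"
    by (rule bij_imp_permutes)
      (use assms bij_betw_cong[of D f "perm_restrict f D" D] in \<open>auto simp: perm_restrict_def\<close>)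
  then have "permutation (perm_restrict f D)"
    using assms(1) by (auto simp: permutation_permutes)
  then have "x \<in> orbit (perm_restrict f D) x" by (rule permutation_self_in_orbit)
  moreover have "orbit f x = orbit (perm_restrict f D) x"
    by (rule orbit_cong0[where A = D])
      (use assms(3) bij_betwE[OF assms(2)] in \<open>auto simp: perm_restrict_def\<close>)
  ultimately have "x \<in> orbit f x" by simp
  then show ?thesis unfolding orbit_altdef mem_Collect_eq by metis
qed

lemma orbit_subset_closed:
  assumes "bij_betw f D D" "x \<in> D" shows "orbit f x \<subseteq> D"
proof
  fix y assume "y \<in> orbit f x"
  then show "y \<in> D" by induction (use assms(2) bij_betwE[OF assms(1)] in blast)+
qed

lemma self_in_orbit:
  assumes "finite D" "bij_betw f D D" "x \<in> D" shows "x \<in> orbit f x"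
  using bij_betw_funpow_period[OF assms] unfolding orbit_altdef mem_Collect_eq by metis

text \<open>
  Going backwards along a cycle of a permutation amounts to going forwards the rest of it; this turns
  the cycles into classes of a generated equivalence relation, to which the merging lemma applies.
\<close>

lemma link_graph_on_iff:
  assumes "finite D" "bij_betw f D D" "x \<in> D"
  shows "(x, y) \<in> link (graph_on D f) \<longleftrightarrow> y \<in> orbit f x"
proof
  assume "(x, y) \<in> link (graph_on D f)"
  then show "y \<in> orbit f x" unfolding link_def
  proof induction
    case base show ?case using self_in_orbit[OF assms] .
  next
    case (step y z)
    from step.hyps(2) consider "z = f y" | "z \<in> D" "y = f z"
      by (auto simp: graph_on_def)
    then show ?case
    proof cases
      case 2
      then have "z \<in> orbit f y"
        using self_in_orbit_step[of z f] self_in_orbit[OF assms(1,2)] by auto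
      then show ?thesis using step.IH orbit_trans by metis
    qed (use step.IH orbit.step in auto)
  qed
next
  assume "y \<in> orbit f x"
  then show "(x, y) \<in> link (graph_on D f)"
  proof induction
    case base show ?case using assms(3) link_incl by (force simp: graph_on_def)
  next
    case (step y)
    then have "y \<in> D" using orbit_subset_closed[OF assms(2,3)] by blast
    then have "(y, f y) \<in> link (graph_on D f)" using link_incl by (force simp: graph_on_def)
    then show ?case using step.IH link_trans by metis
  qed
qed

lemma classes_graph_on:
  assumes "finite D" "bij_betw f D D"
  shows "D // link (graph_on D f) = orbit f ` D"
  using link_graph_on_iff[OF assms] by (auto simp: quotient_def image_iff)

lemma bij_betw_comp_transpose:
  "bij_betw f D D \<Longrightarrow> a \<in> D \<Longrightarrow> b \<in> D \<Longrightarrow> bij_betw (f \<circ> Transposition.transpose a b) D D"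
  by (rule bij_betw_trans[OF _]) (auto simp: bij_betw_def inj_on_def transpose_def image_iff split: if_splits)

lemma link_insert_transpose:
  fixes f :: "'a \<Rightarrow> 'a"
  assumes "a \<in> D" "b \<in> D"
  shows "link (insert (a, b) (graph_on D (f \<circ> Transposition.transpose a b))) =
    link (insert (a, b) (graph_on D f))"
proof -
  have *: "link (insert (a, b) (graph_on D (g \<circ> Transposition.transpose a b))) \<subseteq>
      link (insert (a, b) (graph_on D g))" for g :: "'a \<Rightarrow> 'a"
  proof (rule link_minimal, safe)
    show ab: "(a, b) \<in> link (insert (a, b) (graph_on D g))" using link_incl by blast
    have g: "(x, g x) \<in> link (insert (a, b) (graph_on D g))" if "x \<in> D" for x
      using that link_incl[of "insert (a, b) (graph_on D g)"] by (auto simp: graph_on_def)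
    fix x y assume "(x, y) \<in> graph_on D (g \<circ> Transposition.transpose a b)"
    then have x: "x \<in> D" "y = g (Transposition.transpose a b x)" by (auto simp: graph_on_def)
    consider "x = a" | "x = b" | "x \<noteq> a" "x \<noteq> b" by blast
    then show "(x, y) \<in> link (insert (a, b) (graph_on D g))"
      using x g ab assms by cases (auto intro: link_trans link_sym)
  qed
  show ?thesis using *[of f] *[of "f \<circ> Transposition.transpose a b"]
    by (simp add: comp_assoc transpose_comp_involutory)
qed

text \<open>
  The path \<open>f b\<close>, \<open>f (f b)\<close>, ... returns to \<open>b\<close> without meeting \<open>a\<close>. After the transposition, \<open>a\<close>
  enters this path at \<open>f b\<close> and follows it unchanged up to \<open>b\<close>.
\<close>

lemma transpose_merges_cycles:
  assumes "finite D" "bij_betw f D D" "a \<in> D" "b \<in> D" "b \<notin> orbit f a"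
  shows "b \<in> orbit (f \<circ> Transposition.transpose a b) a"
proof (rule ccontr)
  let ?g = "f \<circ> Transposition.transpose a b"
  assume b: "b \<notin> orbit ?g a"
  have bb: "b \<in> orbit f b" using self_in_orbit[OF assms(1,2,4)] .
  have na: "a \<notin> orbit f b"
    using assms(5) orbit_swap[of b f a] bb by blast
  have "y \<in> orbit ?g a" if "y \<in> orbit f b" for y
    using that
  proof induction
    case base show ?case using orbit.base[of ?g a] by (simp add: comp_def)
  next
    case (step y)
    then have "?g y = f y" using na b by (metis comp_apply transpose_apply_other)
    then show ?case using step.IH orbit.step[of y ?g a] by (simp add: comp_def)
  qed
  then show False using b bb by blast
qed

text \<open>
  Both \<open>f\<close> and \<open>f\<close> composed with the transposition generate the same relation once \<open>a\<close> and \<open>b\<close> are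
  identified, and the identification merges at most two classes.
\<close>

lemma card_cycles_transpose:
  assumes "finite D" "bij_betw f D D" "a \<in> D" "b \<in> D"
  shows "card (orbit (f \<circ> Transposition.transpose a b) ` D) \<le> card (orbit f ` D) + 1"
    and "b \<notin> orbit f a \<Longrightarrow>
      card (orbit (f \<circ> Transposition.transpose a b) ` D) + 1 = card (orbit f ` D)"
proof -
  let ?g = "f \<circ> Transposition.transpose a b"
  let ?r = "graph_on D f" and ?r' = "graph_on D ?g"
  have g: "bij_betw ?g D D" using bij_betw_comp_transpose assms by metis
  note c = classes_graph_on[OF assms(1,2)] classes_graph_on[OF assms(1) g]
  note eq = link_insert_transpose[OF assms(3,4), of f]
  have ins: "card (D // link (insert (a, b) r)) \<le> card (D // link r)"
    "card (D // link r) \<le> card (D // link (insert (a, b) r)) + 1" for r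
    using card_classes_insert[OF assms(1,3,4), of r] link_insert_linked[of a b r]
    by (cases "(a, b) \<in> link r"; simp)+
  show "card (orbit ?g ` D) \<le> card (orbit f ` D) + 1"
    using ins(2)[of ?r'] ins(1)[of ?r] c eq by simp
  assume b: "b \<notin> orbit f a"
  then have "(a, b) \<in> link ?r'" "(a, b) \<notin> link ?r"
    using transpose_merges_cycles assms g link_graph_on_iff by metis+
  then show "card (orbit ?g ` D) + 1 = card (orbit f ` D)"
    using link_insert_linked[of a b ?r'] card_classes_insert[OF assms(1,3,4), of ?r] c eq by simp
qed

section \<open>Euler's inequality for maps with several components\<close>

text \<open>
  If \<open>\<alpha>\<close> has no fixed points then, with \<open>E = |D| / 2\<close>, this reads \<open>V - E + F \<le> 2 c\<close>, doubled to stay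
  in the natural numbers. Involutions with fixed points make an induction possible that inserts the
  edges one by one, starting from isolated vertices, where \<open>V + F = 2 c\<close>. An edge \<open>{a, b}\<close>
  multiplies the face permutation by a transposition: inside a component this creates at most one
  new face; between two components it merges two faces and also the two components.
\<close>

theorem euler_characteristic_le:
  assumes "finite D" "bij_betw f D D"
    and "\<And>x. x \<in> D \<Longrightarrow> \<alpha> x \<in> D" "\<And>x. x \<in> D \<Longrightarrow> \<alpha> (\<alpha> x) = x"
  shows "2 * (card (orbit f ` D) + card (orbit (f \<circ> \<alpha>) ` D)) \<le>
    card {x \<in> D. \<alpha> x \<noteq> x} + 4 * card (D // link (graph_on D f \<union> graph_on D \<alpha>))"
  using assms(3,4)
proof (induction "card {x \<in> D. \<alpha> x \<noteq> x}" arbitrary: \<alpha> rule: less_induct)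
  case less
  let ?r = "\<lambda>\<alpha>. graph_on D f \<union> graph_on D \<alpha>"
  show ?case
  proof (cases "\<forall>x\<in>D. \<alpha> x = x")
    case True
    have "orbit (f \<circ> \<alpha>) x = orbit f x" if "x \<in> D" for x
      by (rule orbit_cong0[OF that, symmetric]) (use True bij_betwE[OF assms(2)] in auto)
    moreover have "link (?r \<alpha>) = link (graph_on D f)"
      by (intro equalityI link_minimal link_mono)
        (use True link_incl[of "graph_on D f"] in \<open>auto simp: graph_on_def\<close>)
    ultimately show ?thesis
      using classes_graph_on[OF assms(1,2)] by (simp cong: image_cong)
  next
    case False
    then obtain a where a: "a \<in> D" "\<alpha> a \<noteq> a" by blast
    define b where "b = \<alpha> a"
    \<comment> \<open>remove the edge formed by the darts \<open>a\<close> and \<open>b\<close>\<close>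
    define \<beta> where "\<beta> = \<alpha>(a := a, b := b)"
    have b: "b \<in> D" "b \<noteq> a" "\<alpha> b = a" using a less.prems by (auto simp: b_def)
    have \<alpha>: "\<alpha> = \<beta> \<circ> Transposition.transpose a b"
      using b by (auto simp: fun_eq_iff transpose_def b_def \<beta>_def)
    have \<beta>: "\<And>x. x \<in> D \<Longrightarrow> \<beta> x \<in> D" "\<And>x. x \<in> D \<Longrightarrow> \<beta> (\<beta> x) = x"
      using less.prems b a by (auto simp: \<beta>_def b_def) (metis)+
    have supp: "{x \<in> D. \<alpha> x \<noteq> x} = insert a (insert b {x \<in> D. \<beta> x \<noteq> x})"
      using a b by (auto simp: \<beta>_def b_def)
    have card: "card {x \<in> D. \<alpha> x \<noteq> x} = card {x \<in> D. \<beta> x \<noteq> x} + 2"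
      unfolding supp using assms(1) b(2) by (simp add: \<beta>_def)
    have IH: "2 * (card (orbit f ` D) + card (orbit (f \<circ> \<beta>) ` D)) \<le>
        card {x \<in> D. \<beta> x \<noteq> x} + 4 * card (D // link (?r \<beta>))"
      by (rule less.hyps) (use card \<beta> in auto)
    have bij: "bij_betw (f \<circ> \<beta>) D D"
      by (rule bij_betw_trans[OF _ assms(2)], rule bij_betw_byWitness[where f' = \<beta>]) (use \<beta> in auto)
    have comp: "f \<circ> \<alpha> = (f \<circ> \<beta>) \<circ> Transposition.transpose a b"
      by (simp add: \<alpha> comp_assoc)
    note tr = card_cycles_transpose[OF assms(1) bij a(1) b(1), folded comp]
    have link: "link (?r \<alpha>) = link (insert (a, b) (?r \<beta>))"
    proof -
      have 1: "(x, \<alpha> x) \<in> link (insert (a, b) (?r \<beta>))" if "x \<in> D" for x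
      proof -
        have "(x, \<alpha> x) \<in> link (insert (a, b) (graph_on D \<beta>))"
          unfolding link_insert_transpose[OF a(1) b(1), of \<beta>, folded \<alpha>, symmetric]
          using that link_incl[of "insert (a, b) (graph_on D \<alpha>)"] by (auto simp: graph_on_def)
        then show ?thesis using link_mono[of "insert (a, b) (graph_on D \<beta>)" "insert (a, b) (?r \<beta>)"]
          by blast
      qed
      have 2: "(x, \<beta> x) \<in> link (?r \<alpha>)" if "x \<in> D" for x
        using that link_incl[of "?r \<alpha>"] by (auto simp: \<beta>_def graph_on_def)
      have 3: "(a, b) \<in> link (?r \<alpha>)"
        using a link_incl[of "?r \<alpha>"] by (auto simp: b_def graph_on_def)
      show ?thesis
        by (intro equalityI link_minimal)
          (use 1 2 3 link_incl[of "?r \<alpha>"] link_incl[of "insert (a, b) (?r \<beta>)"]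
            in \<open>auto simp: graph_on_def\<close>)
    qed
    show ?thesis
    proof (cases "(a, b) \<in> link (?r \<beta>)")
      case True
      then show ?thesis using IH card tr(1) link link_insert_linked[OF True] by simp
    next
      case False
      have "graph_on D (f \<circ> \<beta>) \<subseteq> link (?r \<beta>)"
      proof
        fix z assume "z \<in> graph_on D (f \<circ> \<beta>)"
        then obtain x where x: "x \<in> D" "z = (x, f (\<beta> x))" by (auto simp: graph_on_def)
        then have "(x, \<beta> x) \<in> link (?r \<beta>)" "(\<beta> x, f (\<beta> x)) \<in> link (?r \<beta>)"
          using \<beta>(1) link_incl[of "?r \<beta>"] by (auto simp: graph_on_def)
        then show "z \<in> link (?r \<beta>)" using x link_trans by metis
      qed
      then have "(a, b) \<notin> link (graph_on D (f \<circ> \<beta>))" using False link_minimal by blast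
      then have "b \<notin> orbit (f \<circ> \<beta>) a" using link_graph_on_iff[OF assms(1) bij a(1)] by simp
      then show ?thesis
        using IH card tr(2) link card_classes_insert[OF assms(1) a(1) b(1) False] by simp
    qed
  qed
qed

section \<open>Product maps and the equivariant map into the Platonic map\<close>

text \<open>
  On a finite set, forward invariance under permutations is invariance under the group they generate.
\<close>

definition transitive_on :: "'a set \<Rightarrow> ('a \<Rightarrow> 'a) \<Rightarrow> ('a \<Rightarrow> 'a) \<Rightarrow> bool" where
  "transitive_on D f \<alpha> \<longleftrightarrow>
     (\<forall>S \<subseteq> D. S \<noteq> {} \<longrightarrow> (\<forall>x\<in>S. f x \<in> S \<and> \<alpha> x \<in> S) \<longrightarrow> S = D)"

lemma transitive_onD:
  assumes "transitive_on D f \<alpha>" "x \<in> D" "P x"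
    and "\<And>y. y \<in> D \<Longrightarrow> P y \<Longrightarrow> f y \<in> D \<and> P (f y) \<and> \<alpha> y \<in> D \<and> P (\<alpha> y)" "z \<in> D"
  shows "P z"
proof -
  have "{y \<in> D. P y} = D"
    using assms(1)[unfolded transitive_on_def, rule_format, of "{y \<in> D. P y}"] assms(2-4) by blast
  then show ?thesis using assms(5) by blast
qed

lemma orbit_eq_of_mem:
  assumes "finite D" "bij_betw f D D" "x \<in> D" "y \<in> orbit f x"
  shows "orbit f y = orbit f x"
  using orbit_cyclic_eq3[OF _ assms(4)] self_in_orbit[OF assms(1-3)] by (auto simp: cyclic_on_def)

lemma funpow_map_prod:
  fixes f :: "'a \<Rightarrow> 'a" and g :: "'b \<Rightarrow> 'b"
  shows "(map_prod f g ^^ n) (x, y) = ((f ^^ n) x, (g ^^ n) y)"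
  by (induction n) auto

text \<open>
  The hypothesis says that the monodromy of each cycle of \<open>D\<close> acts trivially on \<open>Q\<close>. Hence the points
  of \<open>Q\<close> over a chosen representative of the cycle lie in different cycles of the product.
\<close>

lemma card_cycles_product_ge:
  assumes D: "finite D" "bij_betw f D D" and Q: "finite Q" "bij_betw g Q Q"
    and per: "\<And>d n q. d \<in> D \<Longrightarrow> (f ^^ n) d = d \<Longrightarrow> q \<in> Q \<Longrightarrow> (g ^^ n) q = q"
  shows "card (orbit f ` D) * card Q \<le> card (orbit (map_prod f g) ` (D \<times> Q))"
proof -
  let ?F = "map_prod f g"
  have F: "bij_betw ?F (D \<times> Q) (D \<times> Q)" using D(2) Q(2) by (rule bij_betw_map_prod)
  define rep where "rep C = (SOME d. d \<in> D \<and> orbit f d = C)" for C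
  have rep: "rep C \<in> D" "orbit f (rep C) = C" if "C \<in> orbit f ` D" for C
    using that unfolding rep_def by (rule imageE, metis (mono_tags, lifting) someI_ex)+
  have "inj_on (\<lambda>(C, q). orbit ?F (rep C, q)) (orbit f ` D \<times> Q)"
  proof (rule inj_onI, clarify)
    fix c q c' q'
    let ?c = "rep (orbit f c)" and ?c' = "rep (orbit f c')"
    assume c: "c \<in> D" "c' \<in> D" "q \<in> Q" "q' \<in> Q"
      and eq: "orbit ?F (?c, q) = orbit ?F (?c', q')"
    have r: "?c \<in> D" "orbit f ?c = orbit f c" "?c' \<in> D" "orbit f ?c' = orbit f c'"
      using rep c by auto
    have "(?c', q') \<in> orbit ?F (?c, q)"
      unfolding eq by (rule self_in_orbit[OF _ F]) (use D Q r c in auto)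
    then obtain n where n: "n > 0" "?c' = (f ^^ n) ?c" "q' = (g ^^ n) q"
      by (auto simp: orbit_altdef funpow_map_prod)
    then have "?c' \<in> orbit f ?c" unfolding orbit_altdef by blast
    then have e: "orbit f c = orbit f c'" using orbit_eq_of_mem[OF D r(1)] r by metis
    then have "q' = q" using n per[of ?c n q] r c by metis
    then show "orbit f c = orbit f c' \<and> q = q'" using e by simp
  qed
  then have "card (orbit f ` D \<times> Q) \<le> card (orbit ?F ` (D \<times> Q))"
    by (rule card_inj_on_le) (use rep D Q in auto)
  then show ?thesis by (simp add: card_cartesian_product)
qed

text \<open>
  Topologically, a covering of the sphere is trivial and so has a section. Here the covering is
  \<open>D \<times> Q \<rightarrow> D\<close>, which the hypotheses on powers keep unbranched, and a count proves it trivial: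
  Euler's inequality provides at least \<open>|Q|\<close> components, while each component contains a point over
  every \<open>d \<in> D\<close>. So mapping \<open>q\<close> to the component of \<open>(d, q)\<close> is a surjection from \<open>Q\<close> onto a set
  at least as large, hence injective, and every component is the graph of a function. Its
  equivariance is the invariance of the component.
\<close>

theorem equivariant_map_exists:
  assumes D: "finite D" "D \<noteq> {}" "bij_betw f D D"
      "\<And>x. x \<in> D \<Longrightarrow> \<alpha> x \<in> D" "\<And>x. x \<in> D \<Longrightarrow> \<alpha> (\<alpha> x) = x" "transitive_on D f \<alpha>"
    and euler: "2 * (card (orbit f ` D) + card (orbit (f \<circ> \<alpha>) ` D)) = card D + 4"
    and Q: "finite Q" "Q \<noteq> {}" "bij_betw g Q Q"
      "\<And>x. x \<in> Q \<Longrightarrow> \<beta> x \<in> Q" "\<And>x. x \<in> Q \<Longrightarrow> \<beta> (\<beta> x) = x"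
    and per: "\<And>d n q. d \<in> D \<Longrightarrow> (f ^^ n) d = d \<Longrightarrow> q \<in> Q \<Longrightarrow> (g ^^ n) q = q"
      "\<And>d n q. d \<in> D \<Longrightarrow> ((f \<circ> \<alpha>) ^^ n) d = d \<Longrightarrow> q \<in> Q \<Longrightarrow> ((g \<circ> \<beta>) ^^ n) q = q"
  shows "\<exists>\<phi>. \<phi> ` D \<subseteq> Q \<and> (\<forall>d\<in>D. \<phi> (f d) = g (\<phi> d) \<and> \<phi> (\<alpha> d) = \<beta> (\<phi> d))"
proof -
  define F where "F = map_prod f g"
  define A where "A = map_prod \<alpha> \<beta>"
  define S where "S = D \<times> Q"
  define R where "R = link (graph_on S F \<union> graph_on S A)"
  have F: "bij_betw F S S" unfolding F_def S_def using D(3) Q(3) by (rule bij_betw_map_prod)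
  have bij\<alpha>: "bij_betw (f \<circ> \<alpha>) D D"
    by (rule bij_betw_trans[OF _ D(3)], rule bij_betw_byWitness[where f' = \<alpha>]) (use D in auto)
  have bij\<beta>: "bij_betw (g \<circ> \<beta>) Q Q"
    by (rule bij_betw_trans[OF _ Q(3)], rule bij_betw_byWitness[where f' = \<beta>]) (use Q in auto)
  have fin: "finite S" using D Q by (simp add: S_def)
  have step: "(p, F x) \<in> R" "(p, A x) \<in> R" if "(p, x) \<in> R" "x \<in> S" for p x
  proof -
    have "(x, F x) \<in> R" "(x, A x) \<in> R"
      using that(2) link_incl[of "graph_on S F \<union> graph_on S A"] by (auto simp: R_def graph_on_def)
    then show "(p, F x) \<in> R" "(p, A x) \<in> R" using that(1) link_trans unfolding R_def by metis+
  qed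
  have comps: "card Q \<le> card (S // R)"
  proof -
    have FA: "F \<circ> A = map_prod (f \<circ> \<alpha>) (g \<circ> \<beta>)" by (simp add: F_def A_def map_prod.comp)
    have "2 * (card (orbit F ` S) + card (orbit (F \<circ> A) ` S)) \<le>
        card {x \<in> S. A x \<noteq> x} + 4 * card (S // R)"
      unfolding R_def by (rule euler_characteristic_le[OF fin F]) (use D Q in \<open>auto simp: A_def S_def\<close>)
    moreover have "card {x \<in> S. A x \<noteq> x} \<le> card D * card Q"
      using card_mono[OF fin, of "{x \<in> S. A x \<noteq> x}"] by (auto simp: S_def card_cartesian_product)
    moreover have "card (orbit f ` D) * card Q \<le> card (orbit F ` S)"
      unfolding F_def S_def using D(1,3) Q(1,3) per(1) by (rule card_cycles_product_ge)
    moreover have "card (orbit (f \<circ> \<alpha>) ` D) * card Q \<le> card (orbit (F \<circ> A) ` S)"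
      unfolding FA S_def using D(1) bij\<alpha> Q(1) bij\<beta> per(2) by (rule card_cycles_product_ge)
    moreover have "2 * (card (orbit f ` D) * card Q + card (orbit (f \<circ> \<alpha>) ` D) * card Q) =
        card D * card Q + 4 * card Q"
      using arg_cong[OF euler, of "\<lambda>x. x * card Q"] by (simp add: algebra_simps)
    moreover have "q \<le> c" if "2 * (a + b) \<le> x + 4 * c" "x \<le> z" "u \<le> a" "v \<le> b"
      "2 * (u + v) = z + 4 * q" for a b c q u v x z :: nat
      using that by presburger
    ultimately show ?thesis by blast
  qed
  have surj: "\<exists>q\<in>Q. (p, (d, q)) \<in> R" if p: "p \<in> S" and d: "d \<in> D" for p d
  proof -
    let ?P = "\<lambda>x. \<exists>q\<in>Q. (p, (x, q)) \<in> R"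
    have g: "g q \<in> Q" if "q \<in> Q" for q using bij_betwE[OF Q(3)] that by blast
    have f: "f x \<in> D" if "x \<in> D" for x using bij_betwE[OF D(3)] that by blast
    have "fst p \<in> D" "snd p \<in> Q" "(p, (fst p, snd p)) \<in> R" using p by (auto simp: S_def R_def)
    then have "fst p \<in> D" "?P (fst p)" by blast+
    moreover have "f y \<in> D \<and> ?P (f y) \<and> \<alpha> y \<in> D \<and> ?P (\<alpha> y)" if y: "y \<in> D" "?P y" for y
    proof -
      obtain q where q: "q \<in> Q" "(p, (y, q)) \<in> R" using y(2) by blast
      then have "(p, (f y, g q)) \<in> R" "(p, (\<alpha> y, \<beta> q)) \<in> R"
        using step[OF q(2)] y(1) by (auto simp: F_def A_def S_def)
      then show ?thesis using q y f g D(4) Q(4) by blast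
    qed
    ultimately show "?P d" using transitive_onD[OF D(6), of "fst p" ?P d] d by blast
  qed
  have uniq: "q = q'" if d: "d \<in> D" "q \<in> Q" "q' \<in> Q" "((d, q), (d, q')) \<in> R" for d q q'
  proof -
    let ?c = "\<lambda>q. R `` {(d, q)}"
    have "S // R \<subseteq> ?c ` Q"
    proof
      fix C assume "C \<in> S // R"
      then obtain p where p: "p \<in> S" "C = R `` {p}" by (auto simp: quotient_def)
      then obtain q where q: "q \<in> Q" "(p, (d, q)) \<in> R" using surj d by blast
      then have "C = ?c q" unfolding p(2) R_def in_class_iff by simp
      then show "C \<in> ?c ` Q" using q by blast
    qed
    then have "card Q \<le> card (?c ` Q)"
      using comps card_mono[of "?c ` Q" "S // R"] Q(1) by simp
    then have "inj_on ?c Q"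
      using Q(1) card_image_le[OF Q(1), of ?c] by (intro eq_card_imp_inj_on) auto
    moreover have "?c q = ?c q'" using d(4) unfolding R_def in_class_iff by simp
    ultimately show ?thesis using d by (auto dest: inj_onD)
  qed
  obtain p where p: "p \<in> S" using D(2) Q(2) by (auto simp: S_def)
  define \<phi> where "\<phi> d = (SOME q. q \<in> Q \<and> (p, (d, q)) \<in> R)" for d
  have \<phi>: "\<phi> d \<in> Q" "(p, (d, \<phi> d)) \<in> R" if "d \<in> D" for d
    using someI_ex[of "\<lambda>q. q \<in> Q \<and> (p, (d, q)) \<in> R"] surj[OF p that] unfolding \<phi>_def by blast+
  have \<phi>I: "\<phi> d = q" if "d \<in> D" "q \<in> Q" "(p, (d, q)) \<in> R" for d q
    using uniq[OF that(1) \<phi>(1)[OF that(1)] that(2)] \<phi>(2)[OF that(1)] that(3) link_sym link_trans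
    unfolding R_def by metis
  show ?thesis
  proof (intro exI[of _ \<phi>] conjI ballI)
    show "\<phi> ` D \<subseteq> Q" using \<phi> by blast
    fix d assume d: "d \<in> D"
    then have "(d, \<phi> d) \<in> S" using \<phi> by (simp add: S_def)
    note st = step[OF \<phi>(2)[OF d] this]
    show "\<phi> (f d) = g (\<phi> d)"
      by (rule \<phi>I) (use st d \<phi>[OF d] bij_betwE[OF D(3)] bij_betwE[OF Q(3)] in \<open>auto simp: F_def\<close>)
    show "\<phi> (\<alpha> d) = \<beta> (\<phi> d)"
      by (rule \<phi>I) (use st d \<phi>[OF d] D(4) Q(4) in \<open>auto simp: A_def\<close>)
  qed
qed

text \<open>
  Since \<open>f\<close> permutes \<open>D\<close>, it maps the fibre over \<open>q\<close> bijectively to the fibre over \<open>g q\<close>.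
\<close>

lemma card_fibre_step:
  assumes "bij_betw f D D" "bij_betw g Q Q" "\<phi> ` D \<subseteq> Q" "\<And>d. d \<in> D \<Longrightarrow> \<phi> (f d) = g (\<phi> d)"
    and "q \<in> Q"
  shows "card {d \<in> D. \<phi> d = g q} = card {d \<in> D. \<phi> d = q}"
proof -
  have "bij_betw f {d \<in> D. \<phi> d = q} {d \<in> D. \<phi> d = g q}"
    unfolding bij_betw_def
  proof
    show "inj_on f {d \<in> D. \<phi> d = q}"
      using assms(1) by (auto simp: bij_betw_def inj_on_def)
    show "f ` {d \<in> D. \<phi> d = q} = {d \<in> D. \<phi> d = g q}"
    proof safe
      fix d assume d: "d \<in> D" "\<phi> d = g q"
      then obtain e where e: "e \<in> D" "d = f e" using assms(1) by (auto simp: bij_betw_def)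
      then have "g (\<phi> e) = g q" "\<phi> e \<in> Q" using d assms(3,4) by auto
      then have "\<phi> e = q" using assms(2,5) by (auto simp: bij_betw_def dest: inj_onD)
      then show "d \<in> f ` {d \<in> D. \<phi> d = q}" using e by blast
    qed (use assms(4) bij_betwE[OF assms(1)] in auto)
  qed
  then show ?thesis by (rule bij_betw_same_card[symmetric])
qed

lemma card_fibre:
  assumes D: "finite D" "bij_betw f D D" "bij_betw \<alpha> D D"
    and Q: "finite Q" "bij_betw g Q Q" "bij_betw \<beta> Q Q" "transitive_on Q g \<beta>"
    and \<phi>: "\<phi> ` D \<subseteq> Q" "\<And>d. d \<in> D \<Longrightarrow> \<phi> (f d) = g (\<phi> d)" "\<And>d. d \<in> D \<Longrightarrow> \<phi> (\<alpha> d) = \<beta> (\<phi> d)"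
    and q: "q \<in> Q"
  shows "card Q * card {d \<in> D. \<phi> d = q} = card D"
proof -
  let ?P = "\<lambda>x. card {d \<in> D. \<phi> d = x} = card {d \<in> D. \<phi> d = q}"
  have "?P x" if x: "x \<in> Q" for x
  proof (rule transitive_onD[OF Q(4) q _ _ x])
    fix y assume "y \<in> Q" "?P y"
    then show "g y \<in> Q \<and> ?P (g y) \<and> \<beta> y \<in> Q \<and> ?P (\<beta> y)"
      using card_fibre_step[OF D(2) Q(2) \<phi>(1,2)] card_fibre_step[OF D(3) Q(3) \<phi>(1,3)]
        bij_betwE[OF Q(2)] bij_betwE[OF Q(3)] by auto
  qed simp
  then have "card Q * card {d \<in> D. \<phi> d = q} = (\<Sum>x\<in>Q. card {d \<in> D. \<phi> d = x})" by simp
  also have "\<dots> = card (\<Union>x\<in>Q. {d \<in> D. \<phi> d = x})"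
    by (rule card_UN_disjoint[symmetric]) (use D Q in auto)
  also have "(\<Union>x\<in>Q. {d \<in> D. \<phi> d = x}) = D" using \<phi>(1) by auto
  finally show ?thesis .
qed

section \<open>Platonic maps\<close>

text \<open>
  The permutation of the natural numbers that rotates each block \<open>{k i..<k i + k}\<close> cyclically.
\<close>

definition rot :: "nat \<Rightarrow> nat \<Rightarrow> nat" where
  "rot k x = k * (x div k) + Suc (x mod k) mod k"

lemma funpow_rot:
  assumes "k > 0" shows "(rot k ^^ j) x = k * (x div k) + (x mod k + j) mod k"
proof (induction j)
  case (Suc j)
  then show ?case using assms by (simp add: rot_def mod_Suc_eq)
qed simp

lemma rot_div: "k > 0 \<Longrightarrow> rot k x div k = x div k"
  by (simp add: rot_def)

lemma rot_less: "k > 0 \<Longrightarrow> k dvd N \<Longrightarrow> x < N \<Longrightarrow> rot k x < N"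
  by (metis rot_div dvd_mult_div_cancel mult.commute div_less_iff_less_mult less_mult_imp_div_less)

text \<open>
  A permutation \<open>f\<close> of \<open>{..<N}\<close> all of whose cycles have length \<open>k\<close> is presented by a relabelling \<open>p\<close>
  that turns it into the block rotation: \<open>p d div k\<close> is the number of the cycle through \<open>d\<close> and
  \<open>p d mod k\<close> the position of \<open>d\<close> on it. Every property below then only requires checking one
  equation for each \<open>d\<close>.
\<close>

locale cycle_labelling =
  fixes k N :: nat and f p :: "nat \<Rightarrow> nat"
  assumes k_pos: "k > 0" and k_dvd: "k dvd N"
    and label_bij: "bij_betw p {..<N} {..<N}"
    and closed: "d < N \<Longrightarrow> f d < N"
    and label_step: "d < N \<Longrightarrow> p (f d) = rot k (p d)"
begin

lemma label_less: "d < N \<Longrightarrow> p d < N"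
  using bij_betwE[OF label_bij] by simp

lemma label_inj: "d < N \<Longrightarrow> e < N \<Longrightarrow> p d = p e \<Longrightarrow> d = e"
  using label_bij by (auto simp: bij_betw_def dest: inj_onD)

lemma cycle_index_less: "d < N \<Longrightarrow> p d div k < N div k"
  using label_less k_pos k_dvd by (simp add: less_mult_imp_div_less)

lemma cycle_index_step: "d < N \<Longrightarrow> p (f d) div k = p d div k"
  using label_step k_pos by (simp add: rot_div)

lemma funpow_label: "d < N \<Longrightarrow> (f ^^ j) d < N \<and> p ((f ^^ j) d) = (rot k ^^ j) (p d)"
  by (induction j) (auto simp: closed label_step)

lemma funpow_period: "d < N \<Longrightarrow> (f ^^ k) d = d"
  using funpow_label[of d k] k_pos by (intro label_inj[of "(f ^^ k) d" d]) (simp_all add: funpow_rot)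

lemma orbit_eq: "d < N \<Longrightarrow> orbit f d = {e. e < N \<and> p e div k = p d div k}"
proof (intro equalityI subsetI CollectI conjI)
  fix e assume "d < N" "e \<in> orbit f d"
  then show "e < N" "p e div k = p d div k"
    using funpow_label k_pos by (auto simp: orbit_altdef funpow_rot)
next
  fix e assume d: "d < N" and "e \<in> {e. e < N \<and> p e div k = p d div k}"
  then have e: "e < N" "p e div k = p d div k" by auto
  \<comment> \<open>adding \<open>k\<close> makes the exponent positive, since an orbit starts with the first power\<close>
  let ?j = "k - p d mod k + p e mod k"
  have "p d mod k < k" using k_pos by simp
  then have "(p d mod k + ?j) mod k = p e mod k" by simp
  then have "p ((f ^^ ?j) d) = p e"
    using funpow_label[OF d, of ?j] k_pos e(2) by (simp add: funpow_rot) (metis mult_div_mod_eq)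
  then have "(f ^^ ?j) d = e" using funpow_label[OF d, of ?j] e label_inj by blast
  moreover have "?j > 0" using \<open>p d mod k < k\<close> by simp
  ultimately show "e \<in> orbit f d" unfolding orbit_altdef mem_Collect_eq by metis
qed

lemma bij: "bij_betw f {..<N} {..<N}"
proof (rule bij_betw_byWitness[where f' = "f ^^ (k - 1)"])
  show "\<forall>d\<in>{..<N}. (f ^^ (k - 1)) (f d) = d"
    using funpow_period k_pos by (metis One_nat_def Suc_pred funpow_simps_right(2) comp_apply lessThan_iff)
  show "\<forall>d\<in>{..<N}. f ((f ^^ (k - 1)) d) = d"
    using funpow_period k_pos by (metis One_nat_def Suc_pred funpow.simps(2) comp_apply lessThan_iff)
  show "f ` {..<N} \<subseteq> {..<N}" using closed by auto
  show "(f ^^ (k - 1)) ` {..<N} \<subseteq> {..<N}" using funpow_label[of _ "k - 1"] by auto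
qed

lemma card_index:
  assumes "i < N div k" shows "card {d. d < N \<and> p d div k = i} = k"
proof -
  have "p ` {d. d < N \<and> p d div k = i} = {x. x < N \<and> x div k = i}"
    using label_bij unfolding bij_betw_def by auto
  also have "\<dots> = {k * i..<k * i + k}"
  proof (intro equalityI subsetI)
    fix x assume x: "x \<in> {k * i..<k * i + k}"
    then have "x < k * Suc i" by simp
    also have "\<dots> \<le> k * (N div k)" using assms by (intro mult_le_mono2) simp
    finally have "x < N" using k_dvd by simp
    then show "x \<in> {x. x < N \<and> x div k = i}"
      using x by (auto simp: div_nat_eqI mult.commute)
  qed (use k_pos in \<open>auto simp: div_less_iff_less_mult mult.commute dest: less_mult_imp_div_less
      simp flip: add.commute[of k] intro: dividend_less_times_div\<close>)
  finally have "card (p ` {d. d < N \<and> p d div k = i}) = k" by simp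
  moreover have "inj_on p {d. d < N \<and> p d div k = i}" using label_inj by (auto intro: inj_onI)
  ultimately show ?thesis by (simp add: card_image)
qed

lemma card_orbit: "d < N \<Longrightarrow> card (orbit f d) = k"
  using orbit_eq card_index cycle_index_less by simp

lemma index_surj:
  assumes "i < N div k" shows "\<exists>d<N. p d div k = i"
  using card_index[OF assms] k_pos by (metis (mono_tags, lifting) card.empty empty_Collect_eq less_irrefl)

lemma card_orbits: "card (orbit f ` {..<N}) = N div k"
proof -
  have "bij_betw (\<lambda>i. {e. e < N \<and> p e div k = i}) {..<N div k} (orbit f ` {..<N})"
  proof (rule bij_betw_imageI)
    show "inj_on (\<lambda>i. {e. e < N \<and> p e div k = i}) {..<N div k}"
    proof (rule inj_onI)
      fix i j assume "i \<in> {..<N div k}" and eq: "{e. e < N \<and> p e div k = i} = {e. e < N \<and> p e div k = j}"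
      then obtain d where "d < N" "p d div k = i" using index_surj by auto
      then show "i = j" using eq by blast
    qed
    show "(\<lambda>i. {e. e < N \<and> p e div k = i}) ` {..<N div k} = orbit f ` {..<N}"
    proof (intro equalityI subsetI)
      fix C assume "C \<in> (\<lambda>i. {e. e < N \<and> p e div k = i}) ` {..<N div k}"
      then obtain i where i: "i < N div k" "C = {e. e < N \<and> p e div k = i}" by auto
      then show "C \<in> orbit f ` {..<N}" using index_surj[OF i(1)] orbit_eq by auto
    qed (use orbit_eq cycle_index_less in auto)
  qed
  then show ?thesis using bij_betw_same_card by fastforce
qed

end

text \<open>
  The darts of a Platonic graph with rotation \<open>\<sigma>\<close> and reversal \<open>\<alpha>\<close>. Vertices and faces enter
  symmetrically, as cycles of \<open>\<sigma>\<close> and of \<open>\<sigma> \<circ> \<alpha>\<close>, which makes the duality below immediate.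
\<close>

locale platonic_map =
  vertex: cycle_labelling k N \<sigma> p + face: cycle_labelling l N "\<sigma> \<circ> \<alpha>" r
  for k l N :: nat and \<sigma> \<alpha> p r :: "nat \<Rightarrow> nat" +
  assumes inv_less: "d < N \<Longrightarrow> \<alpha> d < N"
    and inv_inv: "d < N \<Longrightarrow> \<alpha> (\<alpha> d) = d"
    and inv_outside: "d \<ge> N \<Longrightarrow> \<alpha> d = d"
    and transitive: "transitive_on {..<N} \<sigma> \<alpha>"
    and euler: "2 * (N div k + N div l) = N + 4"
    and no_loop: "d < N \<Longrightarrow> p (\<alpha> d) div k \<noteq> p d div k"
    and no_coloop: "d < N \<Longrightarrow> r (\<alpha> d) div l \<noteq> r d div l"
begin

text \<open>
  The dual map has rotation \<open>\<sigma> \<circ> \<alpha>\<close> and the same reversal, so its face permutation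
  \<open>\<sigma> \<circ> \<alpha> \<circ> \<alpha>\<close> is \<open>\<sigma>\<close> again.
\<close>

lemma dual: "platonic_map l k N (\<sigma> \<circ> \<alpha>) \<alpha> r p"
proof unfold_locales
  fix d assume "d < N"
  then show "(\<sigma> \<circ> \<alpha> \<circ> \<alpha>) d < N" "p ((\<sigma> \<circ> \<alpha> \<circ> \<alpha>) d) = rot k (p d)"
    using vertex.closed vertex.label_step inv_inv by auto
next
  show "transitive_on {..<N} (\<sigma> \<circ> \<alpha>) \<alpha>"
    unfolding transitive_on_def
  proof (intro allI impI)
    fix S assume S: "S \<subseteq> {..<N}" "S \<noteq> {}" "\<forall>x\<in>S. (\<sigma> \<circ> \<alpha>) x \<in> S \<and> \<alpha> x \<in> S"
    have "\<sigma> x \<in> S \<and> \<alpha> x \<in> S" if "x \<in> S" for x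
    proof -
      have "(\<sigma> \<circ> \<alpha>) (\<alpha> x) \<in> S" "\<alpha> (\<alpha> x) = x" using S that inv_inv by blast+
      then show ?thesis using S that by simp
    qed
    then show "S = {..<N}" using transitive S unfolding transitive_on_def by blast
  qed
qed (use inv_less inv_inv inv_outside euler no_loop no_coloop vertex.k_dvd vertex.k_pos
    vertex.label_bij face.k_dvd face.k_pos face.label_bij face.closed face.label_step
    in \<open>auto simp: add.commute\<close>)

lemma size_pos: "N > 0"
  using euler by (cases "N = 0") auto

lemma bij_inv: "bij_betw \<alpha> {..<N} {..<N}"
  by (rule bij_betw_byWitness[where f' = \<alpha>]) (use inv_less inv_inv in auto)

definition skeleton :: "(nat, nat) pre_digraph" where
  "skeleton = \<lparr>verts = {..<N div k}, arcs = {..<N},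
     tail = (\<lambda>d. p d div k), head = (\<lambda>d. p (\<alpha> d) div k)\<rparr>"

lemma faces_skeleton: "faces skeleton \<alpha> \<sigma> = orbit (\<sigma> \<circ> \<alpha>) ` {..<N}"
proof -
  have "face_step \<alpha> \<sigma> = \<sigma> \<circ> \<alpha>" by (auto simp: face_step_def)
  then show ?thesis by (auto simp: faces_def face_of_def skeleton_def)
qed

lemma card_edges_skeleton: "2 * card (edges skeleton \<alpha>) = N"
proof -
  have ne: "d \<noteq> \<alpha> d" if "d < N" for d using no_loop[OF that] by auto
  have "2 * card (edges skeleton \<alpha>) = card (\<Union> (edges skeleton \<alpha>))"
  proof (rule card_partition)
    show "\<And>e. e \<in> edges skeleton \<alpha> \<Longrightarrow> card e = 2"
      using ne by (auto simp: edges_def skeleton_def card_insert_if)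
    show "\<And>e e'. e \<in> edges skeleton \<alpha> \<Longrightarrow> e' \<in> edges skeleton \<alpha> \<Longrightarrow> e \<noteq> e' \<Longrightarrow> e \<inter> e' = {}"
      by (auto simp: edges_def skeleton_def) (metis inv_inv)+
  qed (auto simp: edges_def skeleton_def)
  also have "\<Union> (edges skeleton \<alpha>) = {..<N}"
    using inv_less by (auto simp: edges_def skeleton_def)
  finally show ?thesis by simp
qed

lemma platonic_graph_skeleton: "platonic_graph k l skeleton \<alpha> \<sigma>"
proof -
  have simps: "verts skeleton = {..<N div k}" "arcs skeleton = {..<N}"
    "tail skeleton d = p d div k" "head skeleton d = p (\<alpha> d) div k" for d
    by (simp_all add: skeleton_def)
  have ne: "\<alpha> d \<noteq> d" if "d < N" for d using no_loop[OF that] by auto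
  interpret S: fin_digraph skeleton
    by unfold_locales (auto simp: simps vertex.cycle_index_less inv_less)
  interpret S: bidirected_digraph skeleton \<alpha>
    by (rule S.bidirected_digraphI) (auto simp: simps ne inv_inv inv_outside)
  have out: "out_arcs skeleton v = {d. d < N \<and> p d div k = v}" for v
    by (auto simp: out_arcs_def simps)
  have "plane_graph skeleton \<alpha> \<sigma>"
  proof unfold_locales
    show "arcs skeleton \<noteq> {}" using size_pos by (auto simp: simps)
    show "cyclic_on \<sigma> (out_arcs skeleton v)" if v: "v \<in> verts skeleton" for v
    proof -
      obtain d where "d < N" "p d div k = v" using v vertex.index_surj by (auto simp: simps)
      then show ?thesis using vertex.orbit_eq[of d] by (auto simp: cyclic_on_def out)
    qed
    show "int (card (verts skeleton)) - int (card (edges skeleton \<alpha>)) +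
        int (card (faces skeleton \<alpha> \<sigma>)) = 2"
      using card_edges_skeleton euler by (simp add: simps faces_skeleton face.card_orbits)
    show "connected skeleton"
      unfolding connected_def
    proof (rule strongly_connectedI)
      show "verts (with_proj (mk_symmetric skeleton)) \<noteq> {}"
        using vertex.cycle_index_less size_pos by (auto simp: simps)
      fix u v assume "u \<in> verts (with_proj (mk_symmetric skeleton))"
        "v \<in> verts (with_proj (mk_symmetric skeleton))"
      then have uv: "u \<in> verts skeleton" "v \<in> verts skeleton" by auto
      then obtain d where d: "d < N" "p d div k = u"
        using vertex.index_surj[of u] by (auto simp: simps)
      obtain e where e: "e < N" "p e div k = v"
        using vertex.index_surj[of v] uv by (auto simp: simps)
      have "u \<rightarrow>\<^sup>*\<^bsub>skeleton\<^esub> (p e div k)"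
      proof (rule transitive_onD[OF transitive, of d "\<lambda>x. u \<rightarrow>\<^sup>*\<^bsub>skeleton\<^esub> (p x div k)"])
        show "u \<rightarrow>\<^sup>*\<^bsub>skeleton\<^esub> (p d div k)" using d uv S.reachable_refl by simp
        fix y assume y: "y \<in> {..<N}" "u \<rightarrow>\<^sup>*\<^bsub>skeleton\<^esub> (p y div k)"
        have "(p y div k) \<rightarrow>\<^bsub>skeleton\<^esub> (p (\<alpha> y) div k)"
          using S.in_arcs_imp_in_arcs_ends[of y] y by (simp add: simps)
        then have "u \<rightarrow>\<^sup>*\<^bsub>skeleton\<^esub> (p (\<alpha> y) div k)" using y(2) by (meson S.reachable_adj_trans)
        then show "\<sigma> y \<in> {..<N} \<and> u \<rightarrow>\<^sup>*\<^bsub>skeleton\<^esub> (p (\<sigma> y) div k) \<and>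
            \<alpha> y \<in> {..<N} \<and> u \<rightarrow>\<^sup>*\<^bsub>skeleton\<^esub> (p (\<alpha> y) div k)"
          using y vertex.closed inv_less vertex.cycle_index_step by simp
      qed (use d e in auto)
      then show "u \<rightarrow>\<^sup>*\<^bsub>with_proj (mk_symmetric skeleton)\<^esub> v"
        using e S.reachable_mk_symmetricI by simp
    qed
  qed
  then show ?thesis
    using vertex.card_index face.card_orbit
    by (auto simp: platonic_graph_def out_degree_def out face_degree_def faces_skeleton simps)
qed

lemma platonic_numbers_eq:
  "2 * platonic_n k l = N" "platonic_v k l = N div k" "platonic_f k l = N div l"
  using platonic_numbers[OF platonic_graph_skeleton vertex.k_pos face.k_pos]
    card_edges_skeleton face.card_orbits
  by (auto simp: faces_skeleton) (simp add: skeleton_def)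

end

text \<open>
  If every nonempty invariant set contains \<open>x\<^sub>0\<close>, there cannot be two disjoint ones; but the complement
  of an invariant set of permutations of a finite set is invariant.
\<close>

lemma transitive_onI:
  assumes D: "finite D" "bij_betw f D D" "bij_betw \<alpha> D D"
    and root: "\<And>S. S \<subseteq> D \<Longrightarrow> S \<noteq> {} \<Longrightarrow> (\<And>x. x \<in> S \<Longrightarrow> f x \<in> S \<and> \<alpha> x \<in> S) \<Longrightarrow> x\<^sub>0 \<in> S"
  shows "transitive_on D f \<alpha>"
  unfolding transitive_on_def
proof (intro allI impI)
  fix S assume S: "S \<subseteq> D" "S \<noteq> {}" "\<forall>x\<in>S. f x \<in> S \<and> \<alpha> x \<in> S"
  have comp: "g x \<in> D - S" if g: "bij_betw g D D" "g ` S \<subseteq> S" and x: "x \<in> D - S" for g x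
  proof -
    have "finite S" using D S by (auto dest: finite_subset)
    moreover have "inj_on g S" using g S by (auto simp: bij_betw_def inj_on_subset)
    ultimately have "g ` S = S" using g by (simp add: endo_inj_surj)
    then have "g x \<notin> S" using g(1) S x by (auto simp: bij_betw_def dest: inj_onD)
    then show ?thesis using bij_betwE[OF g(1)] x by blast
  qed
  have "x\<^sub>0 \<in> S" using root S by blast
  moreover have "x\<^sub>0 \<in> D - S" if "D - S \<noteq> {}"
    by (rule root) (use that comp[OF D(2)] comp[OF D(3)] S in auto)
  ultimately show "S = D" using S by blast
qed

text \<open>
  When vertex \<open>v\<close> consists of the darts \<open>{k v..<k v + k}\<close>, connectedness is guaranteed by a spanning
  tree rooted at vertex \<open>0\<close>: the first dart of every other vertex leads to a vertex with a smaller
  number. The least element of an invariant set must then be \<open>0\<close>.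
\<close>

lemma platonic_map_rotI:
  assumes "k > 0" "k dvd N" "l > 0" "l dvd N" "2 * (N div k + N div l) = N + 4"
    and \<alpha>: "\<And>d. d < N \<Longrightarrow> \<alpha> d < N \<and> \<alpha> (\<alpha> d) = d \<and> \<alpha> d div k \<noteq> d div k" "\<And>d. d \<ge> N \<Longrightarrow> \<alpha> d = d"
    and parent: "\<And>v. 0 < v \<Longrightarrow> v < N div k \<Longrightarrow> \<alpha> (k * v) < k * v"
    and r: "inj_on r {..<N}"
      "\<And>d. d < N \<Longrightarrow> r d < N \<and> r (rot k (\<alpha> d)) = rot l (r d) \<and> r (\<alpha> d) div l \<noteq> r d div l"
  shows "platonic_map k l N (rot k) \<alpha> id r"
proof -
  interpret vertex: cycle_labelling k N "rot k" id
    by unfold_locales (use assms rot_less in auto)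
  interpret face: cycle_labelling l N "rot k \<circ> \<alpha>" r
  proof unfold_locales
    show "bij_betw r {..<N} {..<N}"
      using r by (simp add: bij_betw_def endo_inj_surj image_subset_iff)
  qed (use assms rot_less in auto)
  have bij: "bij_betw \<alpha> {..<N} {..<N}"
    by (rule bij_betw_byWitness[where f' = \<alpha>]) (use \<alpha> in auto)
  have "transitive_on {..<N} (rot k) \<alpha>"
  proof (rule transitive_onI[OF _ vertex.bij bij, of 0])
    fix S assume S: "S \<subseteq> {..<N}" "S \<noteq> {}" "\<And>x. x \<in> S \<Longrightarrow> rot k x \<in> S \<and> \<alpha> x \<in> S"
    define m where "m = (LEAST x. x \<in> S)"
    have m: "m \<in> S" "\<And>x. x \<in> S \<Longrightarrow> m \<le> x"
      using S(2) unfolding m_def by (auto intro: LeastI Least_le)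
    have "(rot k ^^ j) m \<in> S" for j by (induction j) (use S m in auto)
    from this[of "k - m mod k"] have "k * (m div k) \<in> S"
      using assms(1) by (simp add: funpow_rot)
    then have "m \<le> k * (m div k)" using m by blast
    then have eq: "k * (m div k) = m" by (simp add: antisym)
    have "m div k < N div k" using vertex.cycle_index_less m S by auto
    moreover have "\<not> \<alpha> m < m" using m S(3) by (meson leD)
    ultimately have "m div k = 0" using parent[of "m div k"] eq by auto
    then show "0 \<in> S" using m eq by simp
  qed simp
  then show ?thesis
    by unfold_locales (use assms in auto)
qed

text \<open>
  The cycle of length \<open>r\<close>: from vertex \<open>v\<close>, the dart \<open>2 v\<close> leads to \<open>v - 1\<close> and the dart \<open>2 v + 1\<close>
  to \<open>v + 1\<close>, modulo \<open>r\<close>. One face consists of the odd darts in increasing order, the other of the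
  even darts in decreasing order, which is why their labels count downwards from \<open>2 r - 1\<close>.
\<close>

lemma cycle_platonic_map:
  assumes "r \<ge> 2" shows "\<exists>\<sigma> \<alpha> p q. platonic_map 2 r (2 * r) \<sigma> \<alpha> p q"
proof -
  define \<alpha> where "\<alpha> d = (if d \<ge> 2 * r then d else if even d
    then (if d = 0 then 2 * r - 1 else d - 1) else (if d = 2 * r - 1 then 0 else d + 1))" for d :: nat
  define q where "q d = (if even d then 2 * r - 1 - d div 2 else d div 2)" for d :: nat
  have even: "\<alpha> 0 = 2 * (r - 1) + 1" "a < r \<Longrightarrow> a > 0 \<Longrightarrow> \<alpha> (2 * a) = 2 * (a - 1) + 1"
    "q (2 * a) = 2 * r - 1 - a" "rot 2 (2 * a) = 2 * a + 1" for a
    using assms by (auto simp: \<alpha>_def q_def rot_def)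
  have odd: "\<alpha> (2 * (r - 1) + 1) = 2 * 0" "a < r - 1 \<Longrightarrow> \<alpha> (2 * a + 1) = 2 * (a + 1)"
    "q (2 * a + 1) = a" "rot 2 (2 * a + 1) = 2 * a" for a
    using assms by (auto simp: \<alpha>_def q_def rot_def)
  have low: "rot r x = Suc x mod r" "x div r = 0" and high: "rot r (r + x) = r + Suc x mod r"
    "(r + x) div r = 1" if "x < r" for x
    using that by (auto simp: rot_def)
  have cases: "(\<exists>a<r. d = 2 * a) \<or> (\<exists>a<r. d = 2 * a + 1)" if "d < 2 * r" for d
    using that by presburger
  have "platonic_map 2 r (2 * r) (rot 2) \<alpha> id q"
  proof (rule platonic_map_rotI)
    show "inj_on q {..<2 * r}"
    proof (rule inj_onI)
      fix x y assume xy: "x \<in> {..<2 * r}" "y \<in> {..<2 * r}" "q x = q y"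
      then show "x = y"
        using cases[of x] cases[of y] by (auto simp: even(3) odd(3)[simplified])
    qed
    fix d assume d: "d < 2 * r"
    show "\<alpha> d < 2 * r \<and> \<alpha> (\<alpha> d) = d \<and> \<alpha> d div 2 \<noteq> d div 2"
      using d assms by (auto simp: \<alpha>_def elim!: evenE oddE)
    have "d = 2 * 0 \<or> (\<exists>a. 0 < a \<and> a < r \<and> d = 2 * a) \<or> d = 2 * (r - 1) + 1 \<or>
        (\<exists>a<r - 1. d = 2 * a + 1)"
      using d by presburger
    then show "q d < 2 * r \<and> q (rot 2 (\<alpha> d)) = rot r (q d) \<and> q (\<alpha> d) div r \<noteq> q d div r"
    proof (elim disjE exE conjE)
      assume d: "d = 2 * 0"
      have e: "q d = r + (r - 1)" "q (\<alpha> d) = r - 1" "q (rot 2 (\<alpha> d)) = r"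
        unfolding d using even(1) even(3)[of 0] even(3)[of "r - 1"] odd(3,4) assms by auto
      show ?thesis unfolding e using high[of "r - 1"] low[of "r - 1"] assms by simp
    next
      fix a assume a: "0 < a" "a < r" and d: "d = 2 * a"
      have e: "q d = r + (r - 1 - a)" "q (\<alpha> d) = a - 1" "q (rot 2 (\<alpha> d)) = r + (r - a)"
        unfolding d even(2)[OF a(2,1)] odd(3,4) even(3) using a by auto
      show ?thesis unfolding e using high[of "r - 1 - a"] low[of "a - 1"] assms a by simp arith
    next
      assume d: "d = 2 * (r - 1) + 1"
      have e: "q d = r - 1" "q (\<alpha> d) = r + (r - 1)" "q (rot 2 (\<alpha> d)) = 0"
        unfolding d odd(1,3) even(3,4) using assms by auto
      show ?thesis unfolding e using high[of "r - 1"] low[of "r - 1"] assms by simp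
    next
      fix a assume a: "a < r - 1" and d: "d = 2 * a + 1"
      have e: "q d = a" "q (\<alpha> d) = r + (r - 2 - a)" "q (rot 2 (\<alpha> d)) = a + 1"
        unfolding d odd(2)[OF a] odd(3) even(3,4) using a by auto
      show ?thesis unfolding e using high[of "r - 2 - a"] low[of "a"] assms a by simp
    qed
  qed (use assms in \<open>auto simp: \<alpha>_def\<close>)
  then show ?thesis by blast
qed

text \<open>
  Beyond its length a table acts as the identity, because arc reversal fixes everything that is not
  an arc.
\<close>

definition table :: "nat list \<Rightarrow> nat \<Rightarrow> nat" where
  "table xs d = (if d < length xs then xs ! d else d)"

text \<open>
  The requirements on the two tables are phrased with list quantifiers so that rewriting evaluates
  them on concrete lists.
\<close>

lemma platonic_map_tableI:
  assumes "length as = N" "length rs = N" "k > 0" "k dvd N" "l > 0" "l dvd N"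
    "2 * (N div k + N div l) = N + 4" "distinct rs"
    and table: "list_all (\<lambda>d. as ! d < N \<and> as ! (as ! d) = d \<and> as ! d div k \<noteq> d div k \<and>
      rs ! d < N \<and> rs ! rot k (as ! d) = rot l (rs ! d) \<and> rs ! (as ! d) div l \<noteq> rs ! d div l) [0..<N]"
    and parent: "list_all (\<lambda>v. as ! (k * v) < k * v) [1..<N div k]"
  shows "platonic_map k l N (rot k) (table as) id (table rs)"
proof (rule platonic_map_rotI)
  have *: "as ! d < N \<and> as ! (as ! d) = d \<and> as ! d div k \<noteq> d div k \<and>
      rs ! d < N \<and> rs ! rot k (as ! d) = rot l (rs ! d) \<and> rs ! (as ! d) div l \<noteq> rs ! d div l"
    if "d < N" for d
    using table that by (auto simp: list_all_iff)
  show "inj_on (table rs) {..<N}"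
    using assms(1,2,8) by (auto simp: inj_on_def table_def nth_eq_iff_index_eq)
  show "table as (k * v) < k * v" if "0 < v" "v < N div k" for v
  proof -
    have "k * v < N" using that assms(3,4) by (metis dvd_mult_div_cancel nat_mult_less_cancel1)
    then show ?thesis using parent that assms(1) by (auto simp: list_all_iff table_def)
  qed
  fix d
  assume d: "d < N"
  show "table as d < N \<and> table as (table as d) = d \<and> table as d div k \<noteq> d div k"
    using *[OF d] d assms(1) by (simp add: table_def)
  show "table rs d < N \<and> table rs (rot k (table as d)) = rot l (table rs d) \<and>
      table rs (table as d) div l \<noteq> table rs d div l"
    using *[OF d] d assms(1,2) rot_less[OF assms(3,4), of "as ! d"] by (simp add: table_def)
qed (use assms in \<open>auto simp: table_def\<close>)

text \<open>
  Dart \<open>3 v + i\<close> is the \<open>i\<close>-th dart around vertex \<open>v\<close>. The vertices are numbered in the order of a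
  breadth-first search, and position \<open>0\<close> of every vertex but the root is the dart towards its
  parent. The first list gives the reversal, the second one the face number and the position on the face, as \<open>l\<close> times the number
  plus the position. The cube and the dodecahedron are encoded in the same way.
\<close>

lemma tetrahedron_platonic_map: "\<exists>\<sigma> \<alpha> p q. platonic_map 3 3 12 \<sigma> \<alpha> p q"
proof -
  have "platonic_map 3 3 12 (rot 3)
    (table [3, 6, 9, 0, 11, 7, 1, 5, 10, 2, 8, 4]) id
    (table [0, 3, 6, 5, 1, 9, 8, 4, 10, 2, 7, 11])"
    by (rule platonic_map_tableI) (simp_all, code_simp+)
  then show ?thesis by blast
qed

lemma cube_platonic_map: "\<exists>\<sigma> \<alpha> p q. platonic_map 3 4 24 \<sigma> \<alpha> p q"
proof -
  have "platonic_map 3 4 24 (rot 3)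
    (table [3, 6, 9, 0, 12, 15, 1, 17, 18, 2, 20, 13, 4, 11, 21, 5, 23, 7, 8, 22, 10, 14, 19, 16]) id
    (table [0, 4, 8, 7, 1, 12, 11, 5, 16, 3, 9, 20, 15, 2, 21, 6, 13, 19, 10, 17, 23, 14, 22, 18])"
    by (rule platonic_map_tableI) (simp_all, code_simp+)
  then show ?thesis by blast
qed

lemma dodecahedron_platonic_map: "\<exists>\<sigma> \<alpha> p q. platonic_map 3 5 60 \<sigma> \<alpha> p q"
proof -
  have "platonic_map 3 5 60 (rot 3)
    (table [3, 6, 9, 0, 12, 15, 1, 18, 21, 2, 24, 27, 4, 29, 30, 5, 33, 19, 7, 17, 36, 8, 39, 25,
       10, 23, 42, 11, 45, 13, 14, 48, 34, 16, 32, 51, 20, 53, 40, 22, 38, 54, 26, 56, 46, 28,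
       44, 49, 31, 47, 57, 35, 59, 37, 41, 58, 43, 50, 55, 52]) id
    (table [0, 5, 10, 9, 1, 15, 14, 6, 20, 4, 11, 25, 19, 2, 30, 8, 16, 35, 24, 7, 36, 13, 21, 40,
       29, 12, 41, 3, 26, 34, 18, 31, 45, 39, 17, 46, 23, 37, 50, 44, 22, 51, 28, 42, 55, 33,
       27, 56, 49, 32, 57, 38, 47, 54, 43, 52, 59, 48, 58, 53])"
    by (rule platonic_map_tableI) (simp_all, code_simp+)
  then show ?thesis by blast
qed

section \<open>Colouring a uniform graph by its map to the Platonic graph\<close>

lemma card_orbit_dvd_period:
  assumes "(f ^^ n) x = x" shows "card (orbit f x) dvd n"
proof (cases "n = 0")
  case False
  then have x: "x \<in> orbit f x" using assms unfolding orbit_altdef mem_Collect_eq by (metis neq0_conv)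
  let ?m = "funpow_dist1 f x x"
  have card: "card (orbit f x) = ?m"
    unfolding orbit_conv_funpow_dist1[OF x] by (simp add: card_image inj_on_funpow_dist1[OF x])
  have "(f ^^ ?m) x = x" by (rule funpow_dist1_prop[OF x])
  then have "(f ^^ (n mod ?m)) x = x" using assms by (simp only: funpow_mod_eq)
  then have "n mod ?m = 0"
    using funpow_dist1_least[of "n mod ?m" f x x] mod_less_divisor[of ?m n] by fastforce
  then show ?thesis unfolding card by (rule mod_0_imp_dvd)
qed simp

lemma (in cycle_labelling) funpow_period_dvd:
  assumes "k dvd n" "d < N" shows "(f ^^ n) d = d"
proof -
  obtain j where "n = k * j" using assms(1) by blast
  moreover have "((f ^^ k) ^^ j) d = d" by (induction j) (auto simp: funpow_period assms(2))
  ultimately show ?thesis by (simp add: funpow_mult)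
qed

lemma (in cycle_labelling) card_fibre_index:
  assumes "finite D" "\<phi> ` D \<subseteq> {..<N}" "\<And>q. q < N \<Longrightarrow> card {a \<in> D. \<phi> a = q} = s" "i < N div k"
  shows "card {a \<in> D. p (\<phi> a) div k = i} = k * s"
proof -
  let ?I = "{q. q < N \<and> p q div k = i}"
  have "{a \<in> D. p (\<phi> a) div k = i} = (\<Union>q\<in>?I. {a \<in> D. \<phi> a = q})" using assms(2) by auto
  also have "card \<dots> = (\<Sum>q\<in>?I. card {a \<in> D. \<phi> a = q})"
    by (rule card_UN_disjoint) (use assms(1) in auto)
  also have "\<dots> = k * s" using assms(3) card_index[OF assms(4)] by simp
  finally show ?thesis .
qed

context plane_graph
begin

lemma bij_nxt: "bij_betw nxt (arcs G) (arcs G)"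
  using nxt_inj nxt_out_arcs by (auto simp: bij_betw_def endo_inj_surj image_subset_iff)

lemma bij_opp: "bij_betw opp (arcs G) (arcs G)"
  by (rule bij_betw_byWitness[where f' = opp]) auto

lemma orbit_nxt: "a \<in> arcs G \<Longrightarrow> orbit nxt a = out_arcs G (tail G a)"
  by (rule orbit_cyclic_eq3[OF nxt_cyclic]) auto

lemma faces_eq_orbits: "faces G opp nxt = orbit (nxt \<circ> opp) ` arcs G"
proof -
  have "face_step opp nxt = nxt \<circ> opp" by (auto simp: face_step_def)
  then show ?thesis by (auto simp: faces_def face_of_def)
qed

lemma out_arcs_nonempty: "v \<in> verts G \<Longrightarrow> out_arcs G v \<noteq> {}"
  using nxt_cyclic by (auto simp: cyclic_on_def)

lemma card_orbits_nxt: "card (orbit nxt ` arcs G) = card (verts G)"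
proof -
  have "bij_betw (out_arcs G) (verts G) (orbit nxt ` arcs G)"
  proof (rule bij_betw_imageI)
    show "inj_on (out_arcs G) (verts G)"
      using out_arcs_nonempty by (fastforce intro!: inj_onI)
    show "out_arcs G ` verts G = orbit nxt ` arcs G"
    proof (intro equalityI subsetI)
      fix C assume "C \<in> out_arcs G ` verts G"
      then obtain v where v: "v \<in> verts G" "C = out_arcs G v" by blast
      then obtain a where "a \<in> out_arcs G v" using out_arcs_nonempty by blast
      then show "C \<in> orbit nxt ` arcs G" using v orbit_nxt[of a] by auto
    qed (use orbit_nxt in auto)
  qed
  then show ?thesis using bij_betw_same_card by fastforce
qed

lemma euler_arcs: "2 * (card (verts G) + card (faces G opp nxt)) = card (arcs G) + 4"
  using euler_sphere card_arcs_edges by presburger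

text \<open>
  An invariant set that contains one arc at a vertex contains all of them, by rotation; with their
  reversals it reaches all neighbours of that vertex.
\<close>

lemma transitive_arcs: "transitive_on (arcs G) nxt opp"
  unfolding transitive_on_def
proof (intro allI impI)
  fix S assume S: "S \<subseteq> arcs G" "S \<noteq> {}" "\<forall>x\<in>S. nxt x \<in> S \<and> opp x \<in> S"
  have full: "b \<in> S" if "a \<in> S" "b \<in> arcs G" "tail G b = tail G a" for a b
  proof -
    have "b \<in> orbit nxt a" using that S orbit_nxt[of a] by auto
    then show "b \<in> S" by induction (use S that in auto)
  qed
  have sc: "strongly_connected G"
    using symmetric_connected_imp_strongly_connected[OF sym_arcs connected] .
  obtain a where a: "a \<in> S" using S by blast
  have "v \<in> tail G ` S" if "tail G a \<rightarrow>\<^sup>*\<^bsub>G\<^esub> v" for v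
    using that
  proof (induction rule: reachable_induct)
    case (step v w)
    obtain b where b: "b \<in> arcs G" "tail G b = v" "head G b = w"
      using step by auto
    then have "b \<in> S" using step.IH full by auto
    then have "opp b \<in> S" "tail G (opp b) = w" using S b by auto
    then show ?case by force
  qed (use a in auto)
  moreover have "tail G a \<rightarrow>\<^sup>*\<^bsub>G\<^esub> v" if "v \<in> verts G" for v
    using sc a S that by (auto simp: strongly_connected_def)
  ultimately have "b \<in> S" if "b \<in> arcs G" for b
    using that full tail_in_verts by (metis (no_types, lifting) imageE)
  then show "S = arcs G" using S by blast
qed

text \<open>
  Counting arcs by vertices and by faces gives \<open>k V \<le> 2 E\<close> and \<open>l F \<le> 2 E\<close>. With Euler's formula
  \<open>V - E + F = 2\<close> this yields \<open>k l < 2 k + 2 l\<close>, that is, \<open>(k - 2) (l - 2) < 4\<close>.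
\<close>

lemma uniform_type:
  assumes "k \<ge> 2" "l \<ge> 2" "\<forall>v\<in>verts G. k dvd out_degree G v"
    "\<forall>F\<in>faces G opp nxt. l dvd face_degree F"
  shows "k = 2 \<or> l = 2 \<or> k = 3 \<and> l \<in> {3, 4, 5} \<or> l = 3 \<and> k \<in> {4, 5}"
proof -
  let ?A = "card (arcs G)" and ?V = "card (verts G)" and ?F = "card (faces G opp nxt)"
  have "k \<le> out_degree G v" if v: "v \<in> verts G" for v
  proof (rule dvd_imp_le)
    show "k dvd out_degree G v" using assms(3) v by blast
    show "out_degree G v > 0"
      using out_arcs_nonempty[OF v] finite_cyclic_on[OF nxt_cyclic[OF v]]
      by (simp add: out_degree_def card_gt_0_iff)
  qed
  then have V: "k * ?V \<le> ?A"
    using sum_mono[of "verts G" "\<lambda>_. k" "out_degree G"] by (simp add: card_arcs_out_degree mult.commute)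
  have "l \<le> face_degree F" if F: "F \<in> faces G opp nxt" for F
  proof -
    obtain a where a: "a \<in> arcs G" "F = face_of opp nxt a" using F by (auto simp: faces_def)
    have "finite F" using face_of_subset[OF a(1)] finite_subset[OF _ finite_arcs] a(2) by simp
    then have "face_degree F > 0" using face_of_self[OF a(1)] a(2) by (auto simp: face_degree_def card_gt_0_iff)
    then show ?thesis using assms(4) F dvd_imp_le by blast
  qed
  then have F: "l * ?F \<le> ?A"
    using sum_mono[of "faces G opp nxt" "\<lambda>_. l" face_degree]
    by (simp add: card_arcs_face_degree mult.commute)
  have "k * l * (2 * (?V + ?F)) = 2 * l * (k * ?V) + 2 * k * (l * ?F)" by (simp add: algebra_simps)
  also have "\<dots> \<le> 2 * l * ?A + 2 * k * ?A" using V F by (intro add_mono mult_left_mono) auto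
  finally have bound: "k * l * ?A + 4 * (k * l) \<le> (2 * l + 2 * k) * ?A"
    unfolding euler_arcs by (simp add: algebra_simps)
  have small: "k * l < 2 * l + 2 * k"
  proof (rule ccontr)
    assume "\<not> k * l < 2 * l + 2 * k"
    then have "(2 * l + 2 * k) * ?A \<le> k * l * ?A" by (intro mult_right_mono) auto
    with bound have "k * l * ?A + 4 * (k * l) \<le> k * l * ?A" by (rule order_trans)
    then show False using assms(1,2) by simp
  qed
  have "k < 4 \<or> l < 4"
  proof (rule ccontr)
    assume "\<not> (k < 4 \<or> l < 4)"
    then obtain x y where "k = 4 + x" "l = 4 + y" by (metis le_Suc_ex not_less)
    then show False using small by (simp add: algebra_simps)
  qed
  then consider "k = 2" | "l = 2" | "k = 3" "l \<ge> 3" | "l = 3" "k \<ge> 3" using assms(1,2) by linarith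
  then show ?thesis using small by cases auto
qed

end

text \<open>
  The cycle of arcs around a vertex (or a face) of \<open>G\<close> has length divisible by \<open>k\<close> (or \<open>l\<close>), while
  \<open>\<sigma>\<close> (or \<open>\<sigma> \<circ> \<alpha>\<close>) has order \<open>k\<close> (or \<open>l\<close>) on the darts of the Platonic map; this is the
  trivial monodromy that yields an equivariant map \<open>\<phi>\<close> from the arcs of \<open>G\<close> to those darts. The arcs leaving the vertices of one colour are those over the \<open>k\<close> darts of one Platonic vertex, and
  there are \<open>s\<close> arcs over each dart; likewise for faces.
\<close>

theorem (in platonic_map) uniform_graph_coloring:
  assumes "uniform_graph k l G opp nxt"
  shows "\<exists>s c d. card (arcs G) = N * s \<and>
    proper_vertex_coloring G (N div k) c \<and> proper_face_coloring G opp nxt (N div l) d \<and>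
    (\<forall>i < N div k. (\<Sum>v | v \<in> verts G \<and> c v = i. out_degree G v) = k * s) \<and>
    (\<forall>j < N div l. (\<Sum>F | F \<in> faces G opp nxt \<and> d F = j. face_degree F) = l * s)"
proof -
  interpret plane_graph G opp nxt using assms by (simp add: uniform_graph_def)
  have uni: "\<And>v. v \<in> verts G \<Longrightarrow> k dvd out_degree G v"
    "\<And>F. F \<in> faces G opp nxt \<Longrightarrow> l dvd face_degree F"
    using assms by (auto simp: uniform_graph_def)
  have per_v: "(\<sigma> ^^ n) q = q" if "a \<in> arcs G" "(nxt ^^ n) a = a" "q \<in> {..<N}" for a n q
  proof -
    have "k dvd card (orbit nxt a)" using uni(1)[of "tail G a"] that orbit_nxt by (simp add: out_degree_def)
    then have "k dvd n" using card_orbit_dvd_period[OF that(2)] by (rule dvd_trans)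
    then show ?thesis using vertex.funpow_period_dvd that(3) by simp
  qed
  have per_f: "((\<sigma> \<circ> \<alpha>) ^^ n) q = q"
    if "a \<in> arcs G" "((nxt \<circ> opp) ^^ n) a = a" "q \<in> {..<N}" for a n q
  proof -
    have "l dvd card (orbit (nxt \<circ> opp) a)"
      using uni(2)[of "orbit (nxt \<circ> opp) a"] that faces_eq_orbits by (simp add: face_degree_def)
    then have "l dvd n" using card_orbit_dvd_period[OF that(2)] by (rule dvd_trans)
    then show ?thesis using face.funpow_period_dvd that(3) by simp
  qed
  have "\<exists>\<phi>. \<phi> ` arcs G \<subseteq> {..<N} \<and>
      (\<forall>a\<in>arcs G. \<phi> (nxt a) = \<sigma> (\<phi> a) \<and> \<phi> (opp a) = \<alpha> (\<phi> a))"
  proof (rule equivariant_map_exists[OF finite_arcs arcs_nonempty bij_nxt])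
    show "2 * (card (orbit nxt ` arcs G) + card (orbit (nxt \<circ> opp) ` arcs G)) = card (arcs G) + 4"
      using euler_arcs by (simp add: card_orbits_nxt faces_eq_orbits)
  qed (use transitive_arcs vertex.bij inv_less inv_inv size_pos per_v per_f in auto)
  then obtain \<phi> where \<phi>: "\<phi> ` arcs G \<subseteq> {..<N}" "\<And>a. a \<in> arcs G \<Longrightarrow> \<phi> (nxt a) = \<sigma> (\<phi> a)"
      "\<And>a. a \<in> arcs G \<Longrightarrow> \<phi> (opp a) = \<alpha> (\<phi> a)" by blast
  have \<phi>_less: "\<phi> a < N" if "a \<in> arcs G" for a using \<phi>(1) that by blast
  define s where "s = card {a \<in> arcs G. \<phi> a = 0}"
  have fibre: "N * card {a \<in> arcs G. \<phi> a = q} = card (arcs G)" if "q < N" for q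
    using card_fibre[OF finite_arcs bij_nxt bij_opp _ vertex.bij bij_inv transitive \<phi>] that by simp
  have s: "card {a \<in> arcs G. \<phi> a = q} = s" if "q < N" for q
  proof -
    have "N * card {a \<in> arcs G. \<phi> a = q} = N * s"
      unfolding s_def fibre[OF that] fibre[OF size_pos] ..
    then show ?thesis using size_pos by simp
  qed
  \<comment> \<open>Equivariance makes the colour independent of the arc chosen at the vertex or face.\<close>
  define c where "c v = p (\<phi> (SOME a. a \<in> out_arcs G v)) div k" for v
  define d where "d F = r (\<phi> (SOME a. a \<in> F)) div l" for F
  have c: "c (tail G a) = p (\<phi> a) div k" if a: "a \<in> arcs G" for a
  proof -
    have *: "b \<in> arcs G \<and> p (\<phi> b) div k = p (\<phi> a) div k" if "b \<in> orbit nxt a" for b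
      using that
      by induction (use a \<phi> \<phi>_less vertex.cycle_index_step nxt_out_arcs in auto)
    have "(SOME b. b \<in> out_arcs G (tail G a)) \<in> orbit nxt a"
      using orbit_nxt[OF a] a someI[of "\<lambda>b. b \<in> out_arcs G (tail G a)" a] by simp
    then show ?thesis unfolding c_def using * by blast
  qed
  have d: "d (face_of opp nxt a) = r (\<phi> a) div l" if a: "a \<in> arcs G" for a
  proof -
    have *: "b \<in> arcs G \<and> r (\<phi> b) div l = r (\<phi> a) div l" if "b \<in> face_of opp nxt a" for b
      using that unfolding face_of_def
    proof induction
      case base
      then show ?case using a \<phi> \<phi>_less[OF a] face.cycle_index_step[of "\<phi> a"] face_step_arcs[OF a]
        by (simp add: face_step_def)
    next
      case (step b)
      then have b: "b \<in> arcs G" by blast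
      then show ?case using step.IH \<phi> \<phi>_less[OF b] face.cycle_index_step[of "\<phi> b"] face_step_arcs[OF b]
        by (simp add: face_step_def)
    qed
    have "(SOME b. b \<in> face_of opp nxt a) \<in> face_of opp nxt a"
      using face_of_self[OF a] by (rule someI)
    then show ?thesis unfolding d_def using * by blast
  qed
  have "card (arcs G) = N * s" using fibre[OF size_pos] by (simp add: s_def)
  moreover have "proper_vertex_coloring G (N div k) c"
    unfolding proper_vertex_coloring_def
  proof (intro conjI ballI)
    fix v assume "v \<in> verts G"
    then obtain a where "a \<in> arcs G" "tail G a = v" using out_arcs_nonempty by fastforce
    then show "c v < N div k" using c[of a] vertex.cycle_index_less \<phi>_less by simp
  next
    fix a assume a: "a \<in> arcs G"
    then show "c (tail G a) \<noteq> c (head G a)"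
      using c[OF a] c[of "opp a"] no_loop[OF \<phi>_less[OF a]] \<phi>(3)[OF a] by simp
  qed
  moreover have "proper_face_coloring G opp nxt (N div l) d"
    unfolding proper_face_coloring_def proper_vertex_coloring_def dual_graph_def
  proof (simp, intro conjI ballI)
    fix F assume "F \<in> faces G opp nxt"
    then show "d F < N div l" using d face.cycle_index_less \<phi>_less by (auto simp: faces_def)
  next
    fix a assume a: "a \<in> arcs G"
    then show "d (face_of opp nxt a) \<noteq> d (face_of opp nxt (opp a))"
      using d[OF a] d[of "opp a"] no_coloop[OF \<phi>_less[OF a]] \<phi>(3)[OF a] by simp
  qed
  moreover have "(\<Sum>v | v \<in> verts G \<and> c v = i. out_degree G v) = k * s" if "i < N div k" for i
  proof -
    have "(\<Sum>v | v \<in> verts G \<and> c v = i. out_degree G v) =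
        card (\<Union>v\<in>{v \<in> verts G. c v = i}. out_arcs G v)"
      unfolding out_degree_def by (rule card_UN_disjoint[symmetric]) auto
    also have "(\<Union>v\<in>{v \<in> verts G. c v = i}. out_arcs G v) = {a \<in> arcs G. p (\<phi> a) div k = i}"
      using c by auto
    finally show ?thesis using vertex.card_fibre_index[OF finite_arcs \<phi>(1) s that] by simp
  qed
  moreover have "(\<Sum>F | F \<in> faces G opp nxt \<and> d F = j. face_degree F) = l * s" if "j < N div l" for j
  proof -
    have fin: "finite F" if "F \<in> faces G opp nxt" for F
      using that face_of_subset finite_subset[OF _ finite_arcs] by (auto simp: faces_def)
    have "(\<Sum>F | F \<in> faces G opp nxt \<and> d F = j. face_degree F) =
        card (\<Union>F\<in>{F \<in> faces G opp nxt. d F = j}. F)"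
      unfolding face_degree_def
    proof (rule card_UN_disjoint[symmetric])
      show "finite {F \<in> faces G opp nxt. d F = j}" by (simp add: faces_def)
      show "\<forall>F\<in>{F \<in> faces G opp nxt. d F = j}. \<forall>F'\<in>{F \<in> faces G opp nxt. d F = j}. F \<noteq> F' \<longrightarrow> F \<inter> F' = {}"
        unfolding faces_def by clarsimp (metis disjoint_iff face_of_eq)
    qed (use fin in auto)
    also have "(\<Union>F\<in>{F \<in> faces G opp nxt. d F = j}. F) = {a \<in> arcs G. r (\<phi> a) div l = j}"
    proof (intro equalityI subsetI)
      fix b assume "b \<in> (\<Union>F\<in>{F \<in> faces G opp nxt. d F = j}. F)"
      then obtain a where a: "a \<in> arcs G" "b \<in> face_of opp nxt a" "d (face_of opp nxt a) = j"
        by (auto simp: faces_def)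
      then have "b \<in> arcs G" using face_of_subset by blast
      then show "b \<in> {a \<in> arcs G. r (\<phi> a) div l = j}" using d[of b] a face_of_eq[OF a(1,2)] by simp
    next
      fix a assume a: "a \<in> {a \<in> arcs G. r (\<phi> a) div l = j}"
      then show "a \<in> (\<Union>F\<in>{F \<in> faces G opp nxt. d F = j}. F)"
        using d[of a] face_of_self[of a] by (auto simp: faces_def)
    qed
    finally show ?thesis using face.card_fibre_index[OF finite_arcs \<phi>(1) s that] by simp
  qed
  ultimately show ?thesis by blast
qed

lemma platonic_map_dual:
  "\<exists>\<sigma> \<alpha> p q. platonic_map k l N \<sigma> \<alpha> p q \<Longrightarrow> \<exists>\<sigma> \<alpha> p q. platonic_map l k N \<sigma> \<alpha> p q"
  using platonic_map.dual by blast

theorem theorem1p1: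
  fixes G :: "('v, 'a) pre_digraph" and opp nxt :: "'a \<Rightarrow> 'a"
    and k l n :: nat and s :: real
  assumes "k \<ge> 2" and "l \<ge> 2"
    and "uniform_graph k l G opp nxt"
    and "n = card (edges G opp)"
    and "s = real n / real (platonic_n k l)"
  shows "s \<in> \<int> \<and>
    vertex_colorable G (platonic_v k l) \<and>
    face_colorable G opp nxt (platonic_f k l) \<and>
    (\<exists>c d. proper_vertex_coloring G (platonic_v k l) c \<and>
       proper_face_coloring G opp nxt (platonic_f k l) d \<and>
       (\<forall>i < platonic_v k l.
          real (\<Sum>v | v \<in> verts G \<and> c v = i. out_degree G v) = real k * s) \<and>
       (\<forall>j < platonic_f k l.
          real (\<Sum>F | F \<in> faces G opp nxt \<and> d F = j. face_degree F) = real l * s))"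
proof -
  interpret plane_graph G opp nxt using assms(3) by (simp add: uniform_graph_def)
  have "k = 2 \<or> l = 2 \<or> k = 3 \<and> l \<in> {3, 4, 5} \<or> l = 3 \<and> k \<in> {4, 5}"
    using uniform_type assms(1-3) by (simp add: uniform_graph_def)
  then have "\<exists>N \<sigma> \<alpha> p q. platonic_map k l N \<sigma> \<alpha> p q"
    using cycle_platonic_map[OF assms(2)] platonic_map_dual[OF cycle_platonic_map[OF assms(1)]]
      tetrahedron_platonic_map cube_platonic_map dodecahedron_platonic_map
      platonic_map_dual[OF cube_platonic_map] platonic_map_dual[OF dodecahedron_platonic_map]
    by (elim disjE conjE insertE emptyE; simp; blast)
  then obtain N \<sigma> \<alpha> p q where "platonic_map k l N \<sigma> \<alpha> p q" by blast
  then interpret P: platonic_map k l N \<sigma> \<alpha> p q .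
  obtain t c d where t: "card (arcs G) = N * t"
    and c: "proper_vertex_coloring G (N div k) c" and d: "proper_face_coloring G opp nxt (N div l) d"
    and ct: "\<And>i. i < N div k \<Longrightarrow> (\<Sum>v | v \<in> verts G \<and> c v = i. out_degree G v) = k * t"
    and dt: "\<And>j. j < N div l \<Longrightarrow> (\<Sum>F | F \<in> faces G opp nxt \<and> d F = j. face_degree F) = l * t"
    using P.uniform_graph_coloring[OF assms(3)] by blast
  have "2 * n = 2 * (platonic_n k l * t)"
    using t card_arcs_edges assms(4) P.platonic_numbers_eq(1) by (metis mult.assoc)
  moreover have "platonic_n k l > 0" using P.platonic_numbers_eq(1) P.size_pos by linarith
  ultimately have s: "s = real t" using assms(5) by simp
  have "real (\<Sum>v | v \<in> verts G \<and> c v = i. out_degree G v) = real k * s" if "i < N div k" for i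
    unfolding ct[OF that] s by simp
  moreover have "real (\<Sum>F | F \<in> faces G opp nxt \<and> d F = j. face_degree F) = real l * s"
    if "j < N div l" for j
    unfolding dt[OF that] s by simp
  ultimately show ?thesis
    using c d s unfolding P.platonic_numbers_eq(2,3) vertex_colorable_def face_colorable_def
    by (intro conjI exI[of _ c] exI[of _ d]) auto
qed

end
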